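(* Let $A$ be a bounded self-adjoint positive operator in a real Hilbert space $\mathcal{H}$ with $m=\inf_{\|x\|=1}(Ax,x)$, $M=\sup_{\|x\|=1}(Ax,x)$, $0<m<M<\infty$. Let $W$ be a bounded positive self-adjoint operator in $\mathcal{H}$, with bounds $c$ and $C$ such that $0<c<C<\infty$ (i.e. $c=\inf_{\|x\|=1}(Wx,x)$, $C=\sup_{\|x\|=1}(Wx,x)$), and assume that $W$ commutes with $A$. Apply a $P$-gradient algorithm, initialized at $x_0$, for the minimisation of $f(x)=\frac12(Ax,x)-(x,y)$, whose minimum is attained at $x^*=A^{-1}y$. With $g_k=Ax_k-y$ the gradient at the $k$-th iterate, define $$R_k(W)=\frac{(Wg_{k+1},g_{k+1})}{(Wg_k,g_k)}$$ if $\|g_k\|\neq0$ and $R_k(W)=1$ otherwise. Then the limit $$R(W,x_0,x^* )=\lim_{n\to\infty}\left[\prod_{k=0}^{n-1}R_k(W)\right]^{1/n}$$ exists for all $x_0,x^*$ in $\mathcal{H}$, and $R(W,x_0,x^* )=R(x_0,x^* )$ does not depend on $W$. In particular, $$R(W,x_0,x^* )=\lim_{n\to\infty}\left(\prod_{k=0}^{n-1}r_k\right)^{1/n},\qquad r_k=\frac{(P(A)g_{k+1},g_{k+1})}{(P(A)g_k,g_k)}.$$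
   Context: $(\cdot,\cdot)$ is the inner product of $\mathcal{H}$ and $\|\cdot\|$ its norm. Let $P(\cdot)$ be a real function on $[m,M]$, infinitely differentiable, with Laurent series $P(z)=\sum_{k=-\infty}^{\infty}c_kz^k$, $c_k\in\mathbb{R}$, such that $0<\sum_{k=-\infty}^\infty c_ka^k<\infty$ for all $a\in[m,M]$. The corresponding $P$-gradient algorithm is $x_{k+1}=x_k-\gamma_kg_k$, with gradient $g_k=Ax_k-y$, where the step-length $\gamma_k$ minimizes $(P(A)g(x_k-\gamma g_k),g(x_k-\gamma g_k))$ with respect to $\gamma$ (with $g(x)=Ax-y$), that is $$\gamma_k=\frac{(P(A)Ag_k,g_k)}{(P(A)A^2g_k,g_k)}\quad\text{if }g_k\neq0.$$ If $g_k=0$ then $x_{k+1}=x_k$, and $r_k$ is set equal to $1$. *)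

theory Defs
  imports "HOL-Analysis.Analysis"
begin

definition selfadjoint_op :: "('a::real_inner \<Rightarrow> 'a) \<Rightarrow> bool" where
  "selfadjoint_op T \<longleftrightarrow> (\<forall>x y. T x \<bullet> y = x \<bullet> T y)"

definition positive_op :: "('a::real_inner \<Rightarrow> 'a) \<Rightarrow> bool" where
  "positive_op T \<longleftrightarrow> (\<forall>x. 0 \<le> T x \<bullet> x)"

definition lower_bound_op :: "('a::real_inner \<Rightarrow> 'a) \<Rightarrow> real" where
  "lower_bound_op T = (INF x\<in>{x. norm x = 1}. T x \<bullet> x)"

definition upper_bound_op :: "('a::real_inner \<Rightarrow> 'a) \<Rightarrow> real" where
  "upper_bound_op T = (SUP x\<in>{x. norm x = 1}. T x \<bullet> x)"

text \<open>
  A two-sided series converges if its two halves converge separately (not necessarily absolutely).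
\<close>

definition bisums :: "(int \<Rightarrow> 'a::real_normed_vector) \<Rightarrow> 'a \<Rightarrow> bool" where
  "bisums f s \<longleftrightarrow>
     (\<exists>s1 s2. (\<lambda>n. f (int n)) sums s1 \<and> (\<lambda>n. f (- int (Suc n))) sums s2 \<and> s = s1 + s2)"

definition bisum :: "(int \<Rightarrow> 'a::real_normed_vector) \<Rightarrow> 'a" where
  "bisum f = (\<Sum>n. f (int n)) + (\<Sum>n. f (- int (Suc n)))"

definition infinitely_differentiable_on :: "(real \<Rightarrow> real) \<Rightarrow> real set \<Rightarrow> bool" where
  "infinitely_differentiable_on f S \<longleftrightarrow>
     (\<exists>D :: nat \<Rightarrow> real \<Rightarrow> real. (\<forall>x\<in>S. D 0 x = f x) \<and>
        (\<forall>k. \<forall>x\<in>S. (D k has_real_derivative D (Suc k) x) (at x within S)))"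

definition op_powi :: "('a \<Rightarrow> 'a) \<Rightarrow> int \<Rightarrow> 'a \<Rightarrow> 'a" where
  "op_powi T k = (if 0 \<le> k then T ^^ nat k else inv T ^^ nat (- k))"

text \<open>
  The operator \<open>P(T) = \<Sum>k. c\<^sub>k T\<^sup>k\<close>, the series being summed pointwise.  For a self-adjoint \<open>T\<close> with
  bounds \<open>0 < m \<le> M\<close>, convergence of the scalar series on \<open>{m..M}\<close> is uniform by Abel's theorem, so
  the operator series converges even in the operator norm, to the same sum.
\<close>

definition laurent_op :: "(int \<Rightarrow> real) \<Rightarrow> ('a::real_inner \<Rightarrow> 'a) \<Rightarrow> 'a \<Rightarrow> 'a" where
  "laurent_op c T x = bisum (\<lambda>k. c k *\<^sub>R op_powi T k x)"

definition quadratic_objective :: "('a::real_inner \<Rightarrow> 'a) \<Rightarrow> 'a \<Rightarrow> 'a \<Rightarrow> real" where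
  "quadratic_objective A y x = 1/2 * (A x \<bullet> x) - x \<bullet> y"

definition grad :: "('a::real_inner \<Rightarrow> 'a) \<Rightarrow> 'a \<Rightarrow> 'a \<Rightarrow> 'a" where
  "grad A y x = A x - y"

text \<open>In the following, \<open>Q\<close> stands for the operator \<open>P(A)\<close>.\<close>

definition step_length :: "('a::real_inner \<Rightarrow> 'a) \<Rightarrow> ('a \<Rightarrow> 'a) \<Rightarrow> 'a \<Rightarrow> real" where
  "step_length Q A g = (Q (A g) \<bullet> g) / (Q (A (A g)) \<bullet> g)"

primrec gradient_iterate ::
  "('a::real_inner \<Rightarrow> 'a) \<Rightarrow> ('a \<Rightarrow> 'a) \<Rightarrow> 'a \<Rightarrow> 'a \<Rightarrow> nat \<Rightarrow> 'a" where
  "gradient_iterate Q A y x0 0 = x0"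
| "gradient_iterate Q A y x0 (Suc k) =
     (let x = gradient_iterate Q A y x0 k; g = grad A y x
      in if g = 0 then x else x - step_length Q A g *\<^sub>R g)"

text \<open>\<open>step_length\<close> is the exact line search for the quadratic form of \<open>Q\<close> at the gradient.\<close>

lemma step_length_minimizes:
  fixes Q A :: "'a::real_inner \<Rightarrow> 'a"
  assumes A: "linear A" "selfadjoint_op A" and Q: "linear Q" "selfadjoint_op Q"
    and commute: "Q \<circ> A = A \<circ> Q"
    and g: "g = grad A y x" and pos: "0 < Q (A (A g)) \<bullet> g"
  shows "is_arg_min (\<lambda>\<gamma>. Q (grad A y (x - \<gamma> *\<^sub>R g)) \<bullet> grad A y (x - \<gamma> *\<^sub>R g))
           (\<lambda>_. True) (step_length Q A g)"
proof -
  define a b d where "a = Q g \<bullet> g" and "b = Q (A g) \<bullet> g" and "d = Q (A (A g)) \<bullet> g"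
  have comm: "Q (A u) = A (Q u)" for u
    using fun_cong[OF commute, of u] by simp
  have sa: "A u \<bullet> v = u \<bullet> A v" "Q u \<bullet> v = u \<bullet> Q v" for u v
    using A(2) Q(2) by (auto simp: selfadjoint_op_def)
  have b2: "Q g \<bullet> A g = b"
    unfolding b_def by (metis comm sa(1))
  have d2: "Q (A g) \<bullet> A g = d"
    unfolding d_def by (metis comm sa(1))
  have gr: "grad A y (x - \<gamma> *\<^sub>R g) = g - \<gamma> *\<^sub>R A g" for \<gamma>
    by (simp add: g grad_def linear_diff[OF A(1)] linear_scale[OF A(1)])
  have form: "Q (grad A y (x - \<gamma> *\<^sub>R g)) \<bullet> grad A y (x - \<gamma> *\<^sub>R g)
      = a - 2 * \<gamma> * b + \<gamma>^2 * d" for \<gamma>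
    using b2 d2 unfolding gr
    by (simp add: linear_diff[OF Q(1)] linear_scale[OF Q(1)] inner_diff_left inner_diff_right
        a_def[symmetric] b_def[symmetric] power2_eq_square algebra_simps)
  have d0: "d > 0" using pos by (simp add: d_def)
  have sq: "a - 2 * \<gamma> * b + \<gamma>^2 * d = a - b^2 / d + d * (\<gamma> - b / d)^2" for \<gamma>
    using d0 by (simp add: field_simps power2_eq_square)
  have "step_length Q A g = b / d"
    by (simp add: step_length_def b_def d_def)
  then show ?thesis
    using d0 by (simp add: is_arg_min_def form sq not_less)
qed

definition rate :: "('a::real_inner \<Rightarrow> 'a) \<Rightarrow> (nat \<Rightarrow> 'a) \<Rightarrow> nat \<Rightarrow> real" where
  "rate V g k = (if g k = 0 then 1 else (V (g (Suc k)) \<bullet> g (Suc k)) / (V (g k) \<bullet> g k))"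

end

theory Submission
  imports Defs "HOL-Computational_Algebra.Fundamental_Theorem_Algebra"
begin

text \<open>
  Write \<open>Q = P(A)\<close> and \<open>\<langle>u, v\<rangle> = (Q u, v)\<close>.  The step length makes \<open>g\<^bsub>k+1\<^esub>\<close> orthogonal to \<open>A g\<^sub>k\<close> for this inner
  product, so that \<open>\<langle>g\<^bsub>k+2\<^esub>, g\<^sub>k\<rangle> = \<langle>g\<^bsub>k+1\<^esub>, g\<^sub>k\<rangle> = \<langle>g\<^bsub>k+1\<^esub>, g\<^bsub>k+1\<^esub>\<rangle>\<close>, and the Cauchy-Schwarz inequality
  says that \<open>r\<^sub>k \<le> r\<^bsub>k+1\<^esub>\<close>.  The geometric means of the \<open>r\<^sub>k\<close> therefore increase, and they are at most
  \<open>1\<close>.  For every \<open>W\<close> the product of the rates telescopes to \<open>(W g\<^sub>n, g\<^sub>n) / (W g\<^sub>0, g\<^sub>0)\<close>, which differs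
  from the same quotient for \<open>Q\<close> by a factor bounded above and away from zero, and the \<open>n\<close>-th root
  of such a factor tends to \<open>1\<close>.

  That \<open>Q\<close> exists and is coercive follows from a spectral inequality: a polynomial that is
  nonnegative on \<open>[m, M]\<close> takes a positive semidefinite value at \<open>A\<close>.  By Abel's summation the Laurent series
  converges uniformly on \<open>[m, M]\<close>, and the inequality transfers convergence and bounds to \<open>A\<close>.
\<close>

section \<open>Polynomials of an operator\<close>

text \<open>Horner's scheme, so that every algebraic law follows by induction over
  \<open>pCons\<close> without sums over coefficients.\<close>

definition poly_op :: "('a::real_vector \<Rightarrow> 'a) \<Rightarrow> real poly \<Rightarrow> 'a \<Rightarrow> 'a" where
  "poly_op T p = fold_coeffs (\<lambda>a f x. a *\<^sub>R x + T (f x)) p (\<lambda>x. 0)"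

lemma poly_op_0 [simp]: "poly_op T 0 x = 0"
  by (simp add: poly_op_def)

lemma poly_op_pCons [simp]:
  assumes "linear T"
  shows "poly_op T (pCons a p) x = a *\<^sub>R x + T (poly_op T p x)"
  \<comment> \<open>In the exceptional case \<open>pCons a p\<close> is \<open>0\<close> and its
    coefficient list is empty; the equation then rests on \<open>T 0 = 0\<close>.\<close>
  by (cases "p = 0 \<and> a = 0") (auto simp: poly_op_def linear_0[OF assms])

lemma poly_op_add:
  assumes "linear T"
  shows "poly_op T (p + q) x = poly_op T p x + poly_op T q x"
  by (induction p q rule: poly_induct2)
     (simp_all add: assms linear_add[OF assms] scaleR_add_left)

lemma poly_op_smult:
  assumes "linear T"
  shows "poly_op T (smult a p) x = a *\<^sub>R poly_op T p x"
  by (induction p) (simp_all add: assms linear_scale[OF assms] scaleR_add_right)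

lemma poly_op_diff:
  assumes "linear T"
  shows "poly_op T (p - q) x = poly_op T p x - poly_op T q x"
  using poly_op_add[OF assms, of "p - q" q x] by simp

lemma poly_op_mult:
  assumes "linear T"
  shows "poly_op T (p * q) x = poly_op T p (poly_op T q x)"
  by (induction p) (simp_all add: assms poly_op_add poly_op_smult)

lemma poly_op_sum:
  assumes "linear T"
  shows "poly_op T (\<Sum>i\<in>I. p i) x = (\<Sum>i\<in>I. poly_op T (p i) x)"
  by (induction I rule: infinite_finite_induct) (simp_all add: poly_op_add[OF assms])

lemma poly_op_monom:
  assumes "linear T"
  shows "poly_op T (monom a n) x = a *\<^sub>R (T ^^ n) x"
  by (induction n)
     (simp_all add: assms monom_0 monom_Suc linear_0[OF assms] linear_scale[OF assms])

lemma linear_poly_op: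
  assumes "linear T"
  shows "linear (poly_op T p)"
proof (induction p)
  case 0
  then show ?case by (simp add: linear_iff)
next
  case (pCons a p)
  then show ?case
    by (auto simp: linear_iff poly_op_pCons[OF assms] linear_add[OF assms]
        linear_scale[OF assms] algebra_simps)
qed

lemma bounded_linear_poly_op:
  assumes "bounded_linear T"
  shows "bounded_linear (poly_op T p)"
proof (induction p)
  case 0
  then show ?case by (simp add: poly_op_def)
next
  case (pCons a p)
  have "bounded_linear (\<lambda>x. a *\<^sub>R x + T (poly_op T p x))"
    by (intro bounded_linear_add bounded_linear_scaleR_right
        bounded_linear_compose[OF assms pCons.IH])
  moreover have "poly_op T (pCons a p) = (\<lambda>x. a *\<^sub>R x + T (poly_op T p x))"
    by (simp add: fun_eq_iff bounded_linear.linear[OF assms])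
  ultimately show ?case by simp
qed

lemma poly_op_commute:
  assumes "linear T"
  shows "poly_op T p (T x) = T (poly_op T p x)"
  by (induction p)
     (simp_all add: assms linear_0[OF assms] linear_add[OF assms] linear_scale[OF assms])

lemma selfadjoint_poly_op:
  assumes T: "linear T" "selfadjoint_op T"
  shows "selfadjoint_op (poly_op T p)"
proof (induction p)
  case 0
  then show ?case by (simp add: selfadjoint_op_def)
next
  case (pCons a p)
  then show ?case
    using T(2)
    by (simp add: selfadjoint_op_def poly_op_pCons[OF T(1)] inner_add_left inner_add_right
        poly_op_commute[OF T(1), symmetric])
qed

section \<open>Real polynomials and their linear and quadratic factors\<close>

lemma map_poly_of_real_add:
  "map_poly of_real (p + q) = (map_poly of_real p + map_poly of_real q :: 'a::real_algebra_1 poly)"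
  by (intro poly_eqI) (simp add: coeff_map_poly)

lemma map_poly_of_real_mult:
  "map_poly of_real (p * q)
     = (map_poly of_real p * map_poly of_real q :: 'a::{comm_semiring_0,real_algebra_1} poly)"
  by (intro poly_eqI) (simp add: coeff_map_poly coeff_mult)

lemma poly_map_poly_of_real:
  "poly (map_poly of_real p) (of_real x :: 'a::{comm_semiring_0,real_algebra_1}) = of_real (poly p x)"
  by (induction p) (simp_all add: map_poly_pCons)

text \<open>The fundamental theorem of algebra gives a complex root \<open>w\<close>. A real root
  splits off a linear factor, a non-real one the quadratic whose roots are \<open>w\<close> and its
  conjugate.\<close>

lemma real_poly_factor:
  fixes p :: "real poly"
  assumes "degree p > 0"
  obtains z r where "p = [:- z, 1:] * r" "degree r < degree p"
  | a b r where "b \<noteq> 0" "p = [:a\<^sup>2 + b\<^sup>2, - 2 * a, 1:] * r" "degree r < degree p"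
proof -
  let ?c = "map_poly of_real :: real poly \<Rightarrow> complex poly"
  have "degree (?c p) > 0"
    using assms by (subst degree_map_poly) auto
  then have "\<not> constant (poly (?c p))"
    by (simp add: constant_degree)
  then obtain w where w: "poly (?c p) w = 0"
    using fundamental_theorem_of_algebra by blast
  define a b where "a = Re w" and "b = Im w"
  have w_eq: "w = Complex a b"
    by (simp add: a_def b_def)
  show thesis
  proof (cases "b = 0")
    case True
    then have "w = of_real a"
      by (simp add: w_eq complex_of_real_def)
    then have "poly p a = 0"
      using w by (simp add: poly_map_poly_of_real)
    then obtain r where r: "p = [:- a, 1:] * r"
      by (auto simp: poly_eq_0_iff_dvd)
    moreover have "r \<noteq> 0"
      using assms r by auto
    ultimately show thesis
      by (intro that(1)[of a r]) (simp_all add: degree_mult_eq del: mult_pCons_left)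
  next
    case False
    define d where "d = [:a\<^sup>2 + b\<^sup>2, - 2 * a, 1:]"
    have dw: "poly (?c d) w = 0"
      by (simp add: d_def w_eq map_poly_pCons complex_eq_iff power2_eq_square algebra_simps)
    have dd: "degree d = 2"
      by (simp add: d_def)
    define s where "s = p mod d"
    have "d \<noteq> 0"
      by (simp add: d_def)
    then have "degree s < 2"
      using degree_mod_less[of d p] dd by (cases "s = 0") (auto simp: s_def)
    then have "s = [:coeff s 0, coeff s 1:]"
      by (intro poly_eqI) (auto simp: coeff_pCons coeff_eq_0 split: nat.split)
    then obtain u v where s: "s = [:u, v:]"
      by blast
    have "p = d * (p div d) + s"
      by (simp add: s_def)
    then have "?c p = ?c d * ?c (p div d) + ?c s"
      by (metis map_poly_of_real_add map_poly_of_real_mult)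
    then have "poly (?c s) w = 0"
      using w dw by simp
    \<comment> \<open>The remainder is \<open>u + v * X\<close>. At \<open>w\<close> its imaginary
      part is \<open>v * b\<close> with \<open>b\<close> nonzero, so \<open>v = 0\<close>, and then
      \<open>u = 0\<close>.\<close>
    then have "u = 0 \<and> v = 0"
      using False by (auto simp: s w_eq map_poly_pCons complex_eq_iff)
    then have r: "p = d * (p div d)"
      using s by (metis \<open>p = d * (p div d) + s\<close> add.right_neutral pCons_0_0)
    moreover have "p div d \<noteq> 0"
      using assms r by auto
    ultimately have "degree p = 2 + degree (p div d)"
      using dd by (metis degree_mult_eq degree_0 zero_neq_numeral)
    then show thesis
      using that(2)[OF False] r unfolding d_def by simp
  qed
qed

section \<open>Quadratic forms of self-adjoint operators\<close>

lemma inner_bound_imp_norm_ge: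
  fixes x y :: "'a::real_inner"
  assumes "d * (x \<bullet> x) \<le> y \<bullet> x"
  shows "d * norm x \<le> norm y"
proof (cases "x = 0")
  case False
  have "d * norm x * norm x \<le> norm y * norm x"
    using assms norm_cauchy_schwarz[of y x]
    by (simp add: power2_norm_eq_inner[symmetric] power2_eq_square mult.assoc)
  then show ?thesis using False by simp
qed simp

text \<open>The form of \<open>S\<close> may be degenerate, so it need not be an inner product. The
  bound comes from the sign of the form along the line \<open>x + t y\<close>, a polynomial in
  \<open>t\<close> of degree at most 2.\<close>

lemma selfadjoint_cauchy_schwarz:
  assumes S: "linear S" "selfadjoint_op S" "positive_op S"
  shows "(S x \<bullet> y)\<^sup>2 \<le> (S x \<bullet> x) * (S y \<bullet> y)"
proof -
  have sym: "S y \<bullet> x = S x \<bullet> y"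
    using S(2) by (metis selfadjoint_op_def inner_commute)
  have quad: "0 \<le> S x \<bullet> x + 2 * t * (S x \<bullet> y) + t\<^sup>2 * (S y \<bullet> y)" for t
  proof -
    have "0 \<le> S (x + t *\<^sub>R y) \<bullet> (x + t *\<^sub>R y)"
      using S(3) by (simp add: positive_op_def)
    then show ?thesis
      by (simp add: linear_add[OF S(1)] linear_scale[OF S(1)] inner_add_left inner_add_right
          sym power2_eq_square algebra_simps)
  qed
  have "0 \<le> S y \<bullet> y"
    using S(3) by (simp add: positive_op_def)
  then consider "S y \<bullet> y = 0" | "S y \<bullet> y > 0" by fastforce
  then show ?thesis
  proof cases
    case 1
    have "S x \<bullet> y = 0"
    proof (rule ccontr)
      assume n: "S x \<bullet> y \<noteq> 0"
      \<comment> \<open>If the form vanishes at \<open>y\<close>, the polynomial in \<open>t\<close>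
        is affine with nonzero slope; at this \<open>t\<close> its value is -1.\<close>
      show False
        using quad[of "- (S x \<bullet> x + 1) / (2 * (S x \<bullet> y))"] n 1 by (simp add: field_simps)
    qed
    then show ?thesis using 1 by simp
  next
    case 2
    \<comment> \<open>This \<open>t\<close> is the minimiser of the quadratic.\<close>
    then show ?thesis
      using quad[of "- (S x \<bullet> y) / (S y \<bullet> y)"] by (simp add: field_simps power2_eq_square)
  qed
qed

text \<open>In operator terms \<open>S^2 <= K S\<close>: Cauchy-Schwarz for the form of
  \<open>S\<close>, applied to \<open>x\<close> and \<open>S x\<close>, leaves a common factor to
  cancel.\<close>

lemma norm_le_form_bound:
  assumes S: "linear S" "selfadjoint_op S" "positive_op S"
    and K: "\<And>x. S x \<bullet> x \<le> K * (x \<bullet> x)"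
  shows "S x \<bullet> S x \<le> K * (S x \<bullet> x)"
proof (cases "S x = 0")
  case False
  have "(S x \<bullet> S x)\<^sup>2 \<le> (S x \<bullet> x) * (S (S x) \<bullet> S x)"
    by (rule selfadjoint_cauchy_schwarz[OF S])
  also have "\<dots> \<le> (S x \<bullet> x) * (K * (S x \<bullet> S x))"
    using S(3) K by (intro mult_left_mono) (auto simp: positive_op_def)
  finally have "(S x \<bullet> S x) * (S x \<bullet> S x) \<le> (K * (S x \<bullet> x)) * (S x \<bullet> S x)"
    by (simp add: power2_eq_square mult_ac)
  moreover have "0 < S x \<bullet> S x" using False by simp
  ultimately show ?thesis by (rule mult_right_le_imp_le)
qed simp

lemma form_le_of_bounded:
  assumes "bounded_linear S"
  obtains K where "K > 0" "\<And>x. \<bar>S x \<bullet> x\<bar> \<le> K * (x \<bullet> x)"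
proof -
  obtain K where K: "K > 0" "\<And>x. norm (S x) \<le> norm x * K"
    using bounded_linear.pos_bounded[OF assms] by blast
  have "\<bar>S x \<bullet> x\<bar> \<le> K * (x \<bullet> x)" for x
  proof -
    have "\<bar>S x \<bullet> x\<bar> \<le> norm (S x) * norm x"
      by (rule Cauchy_Schwarz_ineq2)
    also have "\<dots> \<le> norm x * K * norm x"
      by (intro mult_right_mono K) simp
    finally show ?thesis
      by (simp add: power2_norm_eq_inner[symmetric] power2_eq_square mult_ac)
  qed
  then show thesis using that K(1) by blast
qed

section \<open>The spectral inequality for polynomials, from bounds of the form alone\<close>

locale selfadjoint_bounds =
  fixes T :: "'a::real_inner \<Rightarrow> 'a" and m M :: real
  assumes bounded_linear: "bounded_linear T"
    and selfadjoint: "selfadjoint_op T"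
    and form_ge: "m * (x \<bullet> x) \<le> T x \<bullet> x"
    and form_le: "T x \<bullet> x \<le> M * (x \<bullet> x)"
    and m_le_M: "m \<le> M"
begin

lemma linear: "linear T"
  by (rule bounded_linear.linear[OF bounded_linear])

lemma adjoint: "T x \<bullet> y = x \<bullet> T y"
  using selfadjoint by (simp add: selfadjoint_op_def)

text \<open>Split \<open>p\<close> into real factors. A linear factor with root outside
  \<open>{m..M}\<close> is bounded below by the distance of the root to the interval, a quadratic
  factor by the squared imaginary part of its roots, and the constants multiply under
  composition.\<close>

lemma poly_op_bounded_below:
  assumes "\<And>a. a \<in> {m..M} \<Longrightarrow> poly p a \<noteq> 0"
  shows "\<exists>d>0. \<forall>x. d * norm x \<le> norm (poly_op T p x)"
  using assms
proof (induction "degree p" arbitrary: p rule: less_induct)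
  case less
  have step: "\<exists>d>0. \<forall>x. d * norm x \<le> norm (poly_op T p x)"
    if p: "p = q * r" and r: "degree r < degree p"
      and e: "e > 0" "\<And>x. e * norm x \<le> norm (poly_op T q x)" for q r e
  proof -
    have "poly r a \<noteq> 0" if "a \<in> {m..M}" for a
      using less.prems[OF that] p by auto
    then obtain d where d: "d > 0" "\<And>x. d * norm x \<le> norm (poly_op T r x)"
      using less.hyps[OF r] by blast
    have "e * d * norm x \<le> norm (poly_op T p x)" for x
    proof -
      have "e * (d * norm x) \<le> e * norm (poly_op T r x)"
        using d e by (intro mult_left_mono) auto
      also have "\<dots> \<le> norm (poly_op T p x)"
        using e(2) by (simp add: p poly_op_mult[OF linear])
      finally show ?thesis by (simp add: mult.assoc)
    qed
    then show ?thesis using d(1) e(1) by (intro exI[of _ "e * d"]) auto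
  qed
  show ?case
  proof (cases "degree p = 0")
    case True
    then obtain u where u: "p = [:u:]"
      by (rule degree_eq_zeroE)
    moreover have "u \<noteq> 0"
      using less.prems[of m] m_le_M u by auto
    ultimately show ?thesis
      by (intro exI[of _ "\<bar>u\<bar>"]) (simp add: linear linear_0[OF linear])
  next
    case False
    then have "degree p > 0" by simp
    then show ?thesis
    proof (cases rule: real_poly_factor)
      case (1 z r)
      have "z \<notin> {m..M}"
        using less.prems[of z] 1(1) by auto
      then consider "z < m" | "z > M" by force
      then show ?thesis
      proof cases
        case 1
        show ?thesis
        proof (rule step[OF \<open>p = [:- z, 1:] * r\<close> \<open>degree r < degree p\<close>])
          show "(m - z) * norm x \<le> norm (poly_op T [:- z, 1:] x)" for x
            using form_ge[of x]
            by (intro inner_bound_imp_norm_ge)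
               (simp add: linear linear_0[OF linear] algebra_simps inner_diff_left)
        qed (use 1 in simp)
      next
        case 2
        show ?thesis
        proof (rule step[OF \<open>p = [:- z, 1:] * r\<close> \<open>degree r < degree p\<close>])
          show "(z - M) * norm x \<le> norm (poly_op T [:- z, 1:] x)" for x
          proof -
            have "(z - M) * norm x \<le> norm (- poly_op T [:- z, 1:] x)"
              using form_le[of x]
              by (intro inner_bound_imp_norm_ge)
                 (simp add: linear linear_0[OF linear] algebra_simps inner_diff_left)
            then show ?thesis by simp
          qed
        qed (use 2 in simp)
      qed
    next
      case (2 a b r)
      show ?thesis
      proof (rule step[OF \<open>p = [:a\<^sup>2 + b\<^sup>2, - 2 * a, 1:] * r\<close> \<open>degree r < degree p\<close>])
        show "b\<^sup>2 * norm x \<le> norm (poly_op T [:a\<^sup>2 + b\<^sup>2, - 2 * a, 1:] x)" for x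
        proof (rule inner_bound_imp_norm_ge)
          \<comment> \<open>Complete the square: the quadratic factor is
            \<open>(X - a)^2 + b^2\<close>.\<close>
          have "0 \<le> (T x - a *\<^sub>R x) \<bullet> (T x - a *\<^sub>R x)"
            by simp
          also have "\<dots> = poly_op T [:a\<^sup>2 + b\<^sup>2, - 2 * a, 1:] x \<bullet> x - b\<^sup>2 * (x \<bullet> x)"
            by (simp add: linear linear_0[OF linear] linear_add[OF linear] linear_diff[OF linear]
                linear_scale[OF linear] adjoint inner_diff_left inner_diff_right
                inner_add_left inner_commute power2_eq_square algebra_simps)
          finally show "b\<^sup>2 * (x \<bullet> x) \<le> poly_op T [:a\<^sup>2 + b\<^sup>2, - 2 * a, 1:] x \<bullet> x"
            by simp
        qed
      qed (use 2 in simp)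
    qed
  qed
qed

text \<open>
  If \<open>l\<close> is the greatest lower bound of the form of \<open>p(T)\<close>, then \<open>p(T) - l\<close> is positive but not
  bounded below, so that \<open>p - l\<close> has a root in \<open>{m..M}\<close>.
\<close>

lemma poly_op_form_nonneg:
  assumes "\<And>a. a \<in> {m..M} \<Longrightarrow> 0 \<le> poly p a"
  shows "0 \<le> poly_op T p x \<bullet> x"
proof (rule ccontr)
  assume neg: "\<not> 0 \<le> poly_op T p x \<bullet> x"
  obtain K where K: "K > 0" "\<And>x. \<bar>poly_op T p x \<bullet> x\<bar> \<le> K * (x \<bullet> x)"
    using form_le_of_bounded[OF bounded_linear_poly_op[OF bounded_linear]] by blast
  define B where "B = {l. \<forall>x. l * (x \<bullet> x) \<le> poly_op T p x \<bullet> x}"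
  define l where "l = Sup B"
  have "- K * (z \<bullet> z) \<le> poly_op T p z \<bullet> z" for z
    using K(2)[of z] by (simp add: abs_le_iff)
  then have Kin: "- K \<in> B"
    by (simp add: B_def)
  have x0: "x \<bullet> x > 0"
    using neg by (metis inner_gt_zero_iff inner_zero_right order_refl)
  have ub: "b \<le> (poly_op T p z \<bullet> z) / (z \<bullet> z)" if "b \<in> B" "z \<bullet> z > 0" for b z
    using that by (auto simp: B_def field_simps)
  have l_le: "l \<le> (poly_op T p x \<bullet> x) / (x \<bullet> x)"
    unfolding l_def using Kin ub[OF _ x0] by (intro cSup_least) auto
  also have "\<dots> < 0"
    using neg x0 by (simp add: field_simps)
  finally have l_neg: "l < 0" .
  have l_in: "l * (z \<bullet> z) \<le> poly_op T p z \<bullet> z" for z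
  proof (cases "z = 0")
    case False
    then have z0: "z \<bullet> z > 0" by simp
    have "l \<le> (poly_op T p z \<bullet> z) / (z \<bullet> z)"
      unfolding l_def using Kin ub[OF _ z0] by (intro cSup_least) auto
    then show ?thesis using z0 by (simp add: field_simps)
  qed simp
  define q where "q = p - [:l:]"
  have q: "poly_op T q z = poly_op T p z - l *\<^sub>R z" for z
    by (simp add: q_def poly_op_diff linear linear_0[OF linear])
  have "poly q a \<noteq> 0" if "a \<in> {m..M}" for a
    using assms[OF that] l_neg by (simp add: q_def)
  then obtain d where d: "d > 0" "\<And>z. d * norm z \<le> norm (poly_op T q z)"
    using poly_op_bounded_below by blast
  have S: "linear (poly_op T q)" "selfadjoint_op (poly_op T q)"
    by (simp_all add: linear_poly_op linear selfadjoint_poly_op selfadjoint)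
  have P: "positive_op (poly_op T q)"
    using l_in by (simp add: positive_op_def q inner_diff_left)
  have bd: "poly_op T q z \<bullet> z \<le> (K - l) * (z \<bullet> z)" for z
    using K(2)[of z] by (simp add: q inner_diff_left algebra_simps abs_le_iff)
  have Kl: "K - l > 0" using K(1) l_neg by simp
  \<comment> \<open>Since \<open>q(T)\<close> is bounded below by \<open>d\<close> in norm and
    \<open>q(T)^2 <= (K - l) q(T)\<close>, its form is at least \<open>d^2 / (K - l)\<close>. Thus
    \<open>l\<close> could be raised by that amount, against its choice as supremum.\<close>
  have "l + d\<^sup>2 / (K - l) \<in> B"
    unfolding B_def
  proof safe
    fix z
    have "(d * norm z)\<^sup>2 \<le> (norm (poly_op T q z))\<^sup>2"
      using d by (intro power_mono) auto
    also have "\<dots> \<le> (K - l) * (poly_op T q z \<bullet> z)"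
      using norm_le_form_bound[OF S P bd] by (simp add: power2_norm_eq_inner)
    finally have "d\<^sup>2 * (z \<bullet> z) \<le> (K - l) * (poly_op T q z \<bullet> z)"
      by (simp add: power_mult_distrib power2_norm_eq_inner)
    then have "d\<^sup>2 / (K - l) * (z \<bullet> z) \<le> poly_op T q z \<bullet> z"
      using Kl by (simp add: field_simps)
    then show "(l + d\<^sup>2 / (K - l)) * (z \<bullet> z) \<le> poly_op T p z \<bullet> z"
      by (simp add: q inner_diff_left algebra_simps)
  qed
  moreover have "bdd_above B"
    using ub[OF _ x0] by (auto simp: bdd_above_def)
  ultimately have "l + d\<^sup>2 / (K - l) \<le> l"
    unfolding l_def by (rule cSup_upper)
  then show False using d(1) Kl by (simp add: field_simps)
qed

end

text \<open>Shift to \<open>S + e\<close>, which lies between 0 and \<open>2 e\<close>. Then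
  \<open>(S + e)^2 <= 2 e (S + e)\<close>, and expanding leaves \<open>S^2 <= e^2\<close>.\<close>

lemma norm_le_of_abs_form_le:
  assumes S: "linear S" "selfadjoint_op S"
    and e: "\<And>x. \<bar>S x \<bullet> x\<bar> \<le> e * (x \<bullet> x)" and "0 \<le> e"
  shows "norm (S x) \<le> e * norm x"
proof -
  define S' where "S' x = S x + e *\<^sub>R x" for x
  have S': "linear S'" "selfadjoint_op S'"
    using S unfolding S'_def selfadjoint_op_def linear_iff
    by (auto simp: algebra_simps inner_add_left inner_add_right)
  have form: "S' x \<bullet> x = S x \<bullet> x + e * (x \<bullet> x)" for x
    by (simp add: S'_def inner_add_left)
  have pos: "positive_op S'"
    unfolding positive_op_def form
  proof
    show "0 \<le> S x \<bullet> x + e * (x \<bullet> x)" for x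
      using abs_le_D2[OF e[of x]] by simp
  qed
  have le: "S' x \<bullet> x \<le> 2 * e * (x \<bullet> x)" for x
    unfolding form using abs_le_D1[OF e[of x]] by (simp add: algebra_simps)
  have "S' x \<bullet> S' x \<le> 2 * e * (S' x \<bullet> x)"
    by (rule norm_le_form_bound[OF S' pos le])
  then have "S x \<bullet> S x \<le> e\<^sup>2 * (x \<bullet> x)"
    unfolding form
    by (simp add: S'_def inner_add_left inner_add_right inner_commute power2_eq_square
        algebra_simps)
  then have "(norm (S x))\<^sup>2 \<le> (e * norm x)\<^sup>2"
    by (simp add: power2_norm_eq_inner power_mult_distrib)
  then show ?thesis
    using \<open>0 \<le> e\<close> by (rule power2_le_imp_le[OF _ mult_nonneg_nonneg]) simp
qed

section \<open>Uniform convergence of power series up to the boundary\<close>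

text \<open>Summation by parts moves the differences onto the decreasing weights \<open>u\<close>,
  where they telescope against the bound \<open>e\<close> on the block sums of
  \<open>d\<close>.\<close>

lemma abel_sum_bound:
  fixes d u :: "nat \<Rightarrow> real"
  assumes d: "\<And>n. \<bar>\<Sum>k=i..<n. d k\<bar> \<le> e"
    and u: "\<And>k. 0 \<le> u k" "\<And>k. u (Suc k) \<le> u k"
  shows "\<bar>\<Sum>k=i..<n. d k * u k\<bar> \<le> e * u i"
proof -
  define D where "D j = (\<Sum>k=i..<i+j. d k)" for j
  \<comment> \<open>Subtracting the boundary term of the summation by parts makes the error bound
    telescope; that term is added back at the end.\<close>
  have claim: "\<bar>(\<Sum>k=i..<i+j. d k * u k) - D j * u (i + j)\<bar> \<le> e * (u i - u (i + j))" for j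
  proof (induction j)
    case 0
    then show ?case by (simp add: D_def)
  next
    case (Suc j)
    have D_Suc: "D (Suc j) = D j + d (i + j)"
      by (simp add: D_def)
    have "\<bar>D (Suc j) * (u (i + j) - u (i + Suc j))\<bar> \<le> e * (u (i + j) - u (i + Suc j))"
      using d[of "i + Suc j"] u(2)[of "i + j"]
      by (simp add: abs_mult D_def mult_right_mono)
    moreover have "(\<Sum>k=i..<i + Suc j. d k * u k) - D (Suc j) * u (i + Suc j)
        = ((\<Sum>k=i..<i+j. d k * u k) - D j * u (i + j)) + D (Suc j) * (u (i + j) - u (i + Suc j))"
      by (simp add: D_Suc algebra_simps)
    ultimately have "\<bar>(\<Sum>k=i..<i + Suc j. d k * u k) - D (Suc j) * u (i + Suc j)\<bar>
        \<le> e * (u i - u (i + j)) + e * (u (i + j) - u (i + Suc j))"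
      using Suc.IH by linarith
    then show ?case by (simp add: algebra_simps)
  qed
  have e0: "0 \<le> e" using d[of i] by simp
  show ?thesis
  proof (cases "n \<ge> i")
    case True
    then obtain j where n: "n = i + j"
      using le_Suc_ex by blast
    have "\<bar>D j * u (i + j)\<bar> \<le> e * u (i + j)"
      using d[of "i + j"] u(1)[of "i + j"] by (simp add: abs_mult D_def mult_right_mono)
    then show ?thesis
      using claim[of j] by (simp add: n algebra_simps)
  next
    case False
    then show ?thesis using e0 u(1) by simp
  qed
qed

text \<open>\<open>N\<close> depends on \<open>d\<close> and \<open>e\<close> alone. The weights
  \<open>u\<close> come after it, so that one \<open>N\<close> later serves every point of an
  interval.\<close>

lemma abel_uniform_Cauchy:
  fixes d :: "nat \<Rightarrow> real"
  assumes "summable d" and "0 < e"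
  shows "\<exists>N. \<forall>i\<ge>N. \<forall>n u. (\<forall>k. 0 \<le> u k \<and> u k \<le> 1 \<and> u (Suc k) \<le> u k) \<longrightarrow>
    \<bar>\<Sum>k=i..<n. d k * u k\<bar> \<le> e"
proof -
  obtain N where N: "\<And>i n. N \<le> i \<Longrightarrow> \<bar>\<Sum>k=i..<n. d k\<bar> < e"
    using assms unfolding summable_Cauchy by (metis real_norm_def)
  have "\<bar>\<Sum>k=i..<n. d k * u k\<bar> \<le> e"
    if "N \<le> i" and u: "\<forall>k. 0 \<le> u k \<and> u k \<le> 1 \<and> u (Suc k) \<le> u k" for i n u
  proof -
    have "\<bar>\<Sum>k=i..<n. d k * u k\<bar> \<le> e * u i"
      using u less_imp_le[OF N[OF that(1)]] by (intro abel_sum_bound) auto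
    also have "\<dots> \<le> e * 1"
      using assms(2) u by (intro mult_left_mono) auto
    finally show ?thesis by simp
  qed
  then show ?thesis by blast
qed

text \<open>Phrased with finite blocks instead of limits, because finite blocks are Laurent
  polynomials, to which the spectral inequality applies.\<close>

definition uniformly_Cauchy_series_on :: "real set \<Rightarrow> (nat \<Rightarrow> real \<Rightarrow> real) \<Rightarrow> bool" where
  "uniformly_Cauchy_series_on S f \<longleftrightarrow>
     (\<forall>e>0. \<exists>N. \<forall>i\<ge>N. \<forall>n. \<forall>a\<in>S. \<bar>\<Sum>k=i..<n. f k a\<bar> \<le> e)"

text \<open>Convergence at the right endpoint suffices: the weights \<open>(a / M) ^ k\<close>
  decrease in \<open>k\<close> and are at most 1.\<close>

lemma uniformly_Cauchy_power_series:
  fixes d :: "nat \<Rightarrow> real"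
  assumes "0 < m" "m \<le> M" and d: "summable (\<lambda>k. d k * M ^ k)"
  shows "uniformly_Cauchy_series_on {m..M} (\<lambda>k a. d k * a ^ k)"
  unfolding uniformly_Cauchy_series_on_def
proof (intro allI impI)
  fix e :: real assume "0 < e"
  obtain N where N: "\<forall>i\<ge>N. \<forall>n u. (\<forall>k. 0 \<le> u k \<and> u k \<le> 1 \<and> u (Suc k) \<le> u k) \<longrightarrow>
    \<bar>\<Sum>k=i..<n. (d k * M ^ k) * u k\<bar> \<le> e"
    using abel_uniform_Cauchy[OF d \<open>0 < e\<close>] by blast
  show "\<exists>N. \<forall>i\<ge>N. \<forall>n. \<forall>a\<in>{m..M}. \<bar>\<Sum>k=i..<n. d k * a ^ k\<bar> \<le> e"
  proof (intro exI[of _ N] allI impI ballI)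
    fix i n a assume i: "N \<le> i" and a: "a \<in> {m..M}"
    have t: "0 \<le> a / M" "a / M \<le> 1"
      using a assms by auto
    have "\<bar>\<Sum>k=i..<n. (d k * M ^ k) * (a / M) ^ k\<bar> \<le> e"
      using i t
      by (intro N[rule_format] conjI power_le_one power_decreasing zero_le_power) auto
    moreover have "(d k * M ^ k) * (a / M) ^ k = d k * a ^ k" for k
      using assms by (simp add: power_divide)
    ultimately show "\<bar>\<Sum>k=i..<n. d k * a ^ k\<bar> \<le> e" by simp
  qed
qed

text \<open>For negative exponents the left endpoint is decisive, with weights
  \<open>(m / a) ^ Suc k\<close>.\<close>

lemma uniformly_Cauchy_inverse_power_series:
  fixes d :: "nat \<Rightarrow> real"
  assumes "0 < m" and d: "summable (\<lambda>k. d k * inverse (m ^ Suc k))"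
  shows "uniformly_Cauchy_series_on {m..M} (\<lambda>k a. d k * inverse (a ^ Suc k))"
  unfolding uniformly_Cauchy_series_on_def
proof (intro allI impI)
  fix e :: real assume "0 < e"
  obtain N where N: "\<forall>i\<ge>N. \<forall>n u. (\<forall>k. 0 \<le> u k \<and> u k \<le> 1 \<and> u (Suc k) \<le> u k) \<longrightarrow>
    \<bar>\<Sum>k=i..<n. (d k * inverse (m ^ Suc k)) * u k\<bar> \<le> e"
    using abel_uniform_Cauchy[OF d \<open>0 < e\<close>] by blast
  show "\<exists>N. \<forall>i\<ge>N. \<forall>n. \<forall>a\<in>{m..M}. \<bar>\<Sum>k=i..<n. d k * inverse (a ^ Suc k)\<bar> \<le> e"
  proof (intro exI[of _ N] allI impI ballI)
    fix i n a assume i: "N \<le> i" and a: "a \<in> {m..M}"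
    have t: "0 \<le> m / a" "m / a \<le> 1"
      using a assms by auto
    have "\<bar>\<Sum>k=i..<n. (d k * inverse (m ^ Suc k)) * (m / a) ^ Suc k\<bar> \<le> e"
      using i t
      by (intro N[rule_format] conjI power_le_one power_decreasing zero_le_power) auto
    moreover have "(d k * inverse (m ^ Suc k)) * (m / a) ^ Suc k = d k * inverse (a ^ Suc k)" for k
      using assms by (simp add: power_divide field_simps)
    ultimately show "\<bar>\<Sum>k=i..<n. d k * inverse (a ^ Suc k)\<bar> \<le> e"
      by (simp del: power_Suc)
  qed
qed

text \<open>Fix the start of a block and let its end tend to infinity.\<close>

lemma uniformly_Cauchy_series_on_remainder:
  assumes f: "uniformly_Cauchy_series_on S f" and sums: "\<And>a. a \<in> S \<Longrightarrow> (\<lambda>k. f k a) sums s a"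
    and "0 < e"
  obtains N where "\<And>i a. \<lbrakk>N \<le> i; a \<in> S\<rbrakk> \<Longrightarrow> \<bar>s a - (\<Sum>k<i. f k a)\<bar> \<le> e"
proof -
  obtain N where N: "\<And>i n a. \<lbrakk>N \<le> i; a \<in> S\<rbrakk> \<Longrightarrow> \<bar>\<Sum>k=i..<n. f k a\<bar> \<le> e"
    using f \<open>0 < e\<close> unfolding uniformly_Cauchy_series_on_def by metis
  have "\<bar>s a - (\<Sum>k<i. f k a)\<bar> \<le> e" if "N \<le> i" "a \<in> S" for i a
  proof (rule LIMSEQ_le_const2)
    show "(\<lambda>n. \<bar>(\<Sum>k<n. f k a) - (\<Sum>k<i. f k a)\<bar>) \<longlonglongrightarrow> \<bar>s a - (\<Sum>k<i. f k a)\<bar>"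
      using sums[OF that(2)] unfolding sums_def by (intro tendsto_intros)
    have "(\<Sum>k<n. f k a) - (\<Sum>k<i. f k a) = (\<Sum>k=i..<n. f k a)" if "i \<le> n" for n
      using sum_diff_nat_ivl[of 0 i n "\<lambda>k. f k a"] that by (simp add: atLeast0LessThan)
    then show "\<exists>n0. \<forall>n\<ge>n0. \<bar>(\<Sum>k<n. f k a) - (\<Sum>k<i. f k a)\<bar> \<le> e"
      using N[OF that] by (intro exI[of _ i]) simp
  qed
  then show thesis using that by blast
qed

section \<open>Laurent series of a positive definite operator\<close>

lemma selfadjoint_funpow:
  assumes "selfadjoint_op T"
  shows "(T ^^ n) x \<bullet> y = x \<bullet> (T ^^ n) y"
  using assms by (induction n arbitrary: x y) (simp_all add: selfadjoint_op_def funpow_swap1)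

locale positive_definite_bounds = selfadjoint_bounds T m M
  for T :: "'a::{real_inner, complete_space} \<Rightarrow> 'a" and m M +
  assumes m_pos: "0 < m"
begin

lemma inj: "inj T"
proof (rule injI)
  fix x y assume "T x = T y"
  then have "m * ((x - y) \<bullet> (x - y)) \<le> 0"
    using form_ge[of "x - y"] by (simp add: linear_diff[OF linear])
  then have "(x - y) \<bullet> (x - y) \<le> 0"
    using m_pos by (simp add: mult_le_0_iff not_le)
  then show "x = y"
    by (metis eq_iff_diff_eq_0 inner_eq_zero_iff inner_ge_zero order_antisym)
qed

text \<open>
  For small \<open>t\<close> the map \<open>x \<mapsto> x - t (T x - y)\<close> is a contraction; its fixed point solves \<open>T x = y\<close>.
\<close>

lemma surj: "surj T"
proof -
  obtain K0 where K0: "K0 > 0" "\<And>x. norm (T x) \<le> norm x * K0"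
    using bounded_linear.pos_bounded[OF bounded_linear] by blast
  \<comment> \<open>The maximum ensures \<open>m <= K\<close>, so that the radicand of
    \<open>q\<close> is nonnegative, even when the space is trivial.\<close>
  define K where "K = max K0 m"
  have K: "K > 0" "m \<le> K" "norm (T x) \<le> K * norm x" for x
  proof -
    have "norm x * K0 \<le> K * norm x"
      by (subst mult.commute) (simp add: K_def mult_right_mono)
    then show "norm (T x) \<le> K * norm x"
      using K0(2)[of x] by linarith
  qed (use K0 in \<open>auto simp: K_def\<close>)
  \<comment> \<open>The squared contraction factor is at most \<open>1 - 2 t m + t^2 K^2\<close>;
    this \<open>t\<close> minimises that bound, with minimum \<open>q^2\<close>.\<close>
  define t q where "t = m / K\<^sup>2" and "q = sqrt (1 - m\<^sup>2 / K\<^sup>2)"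
  have mK: "m\<^sup>2 / K\<^sup>2 \<le> 1" "0 < m\<^sup>2 / K\<^sup>2"
    using K m_pos by (auto intro!: power_mono)
  have contr: "norm (x - t *\<^sub>R T x) \<le> q * norm x" for x
  proof (rule power2_le_imp_le)
    have "T x \<bullet> T x \<le> K\<^sup>2 * (x \<bullet> x)"
      using power_mono[OF K(3)[of x] norm_ge_zero, of 2]
      by (simp add: power2_norm_eq_inner power_mult_distrib)
    then have 1: "t\<^sup>2 * (T x \<bullet> T x) \<le> t\<^sup>2 * (K\<^sup>2 * (x \<bullet> x))"
      by (intro mult_left_mono) auto
    have 2: "2 * t * (m * (x \<bullet> x)) \<le> 2 * t * (T x \<bullet> x)"
      using form_ge m_pos by (intro mult_left_mono) (auto simp: t_def)
    have "(norm (x - t *\<^sub>R T x))\<^sup>2 = x \<bullet> x - 2 * t * (T x \<bullet> x) + t\<^sup>2 * (T x \<bullet> T x)"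
      unfolding power2_norm_eq_inner
      by (simp add: inner_diff_left inner_diff_right inner_commute power2_eq_square algebra_simps)
    also have "\<dots> \<le> x \<bullet> x - 2 * t * (m * (x \<bullet> x)) + t\<^sup>2 * (K\<^sup>2 * (x \<bullet> x))"
      using 1 2 by linarith
    also have "\<dots> = (1 - m\<^sup>2 / K\<^sup>2) * (x \<bullet> x)"
      using K(1) by (simp add: t_def field_simps power2_eq_square)
    also have "\<dots> = (q * norm x)\<^sup>2"
      using mK by (simp add: q_def power_mult_distrib power2_norm_eq_inner)
    finally show "(norm (x - t *\<^sub>R T x))\<^sup>2 \<le> (q * norm x)\<^sup>2" .
  qed (use mK in \<open>simp add: q_def\<close>)
  have "\<exists>x. T x = y" for y
  proof -
    have "\<exists>!x. x - t *\<^sub>R (T x - y) = x"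
    proof (rule banach_fix_type)
      show "0 \<le> q" "q < 1"
        using mK by (simp_all add: q_def)
      show "\<forall>x z. dist (x - t *\<^sub>R (T x - y)) (z - t *\<^sub>R (T z - y)) \<le> q * dist x z"
      proof (intro allI)
        fix x z
        have "x - t *\<^sub>R (T x - y) - (z - t *\<^sub>R (T z - y)) = (x - z) - t *\<^sub>R T (x - z)"
          by (simp add: linear_diff[OF linear] algebra_simps)
        then show "dist (x - t *\<^sub>R (T x - y)) (z - t *\<^sub>R (T z - y)) \<le> q * dist x z"
          using contr[of "x - z"] by (simp only: dist_norm)
      qed
    qed
    then obtain x where "t *\<^sub>R (T x - y) = 0" by auto
    then show ?thesis using K(1) m_pos by (auto simp: t_def)
  qed
  then show ?thesis by (metis surjI)
qed

lemma T_inv [simp]: "T (inv T x) = x"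
  by (rule surj_f_inv_f[OF surj])

lemma inv_T [simp]: "inv T (T x) = x"
  by (rule inv_f_f[OF inj])

lemma linear_inv: "linear (inv T)"
  by (intro linearI; rule injD[OF inj])
     (simp_all add: linear_add[OF linear] linear_scale[OF linear])

lemma selfadjoint_inv: "selfadjoint_op (inv T)"
  unfolding selfadjoint_op_def by (metis T_inv adjoint)

lemma op_powi_add: "op_powi T k (x + y) = op_powi T k x + op_powi T k y"
proof -
  have "(S ^^ n) (x + y) = (S ^^ n) x + (S ^^ n) y" if "linear S" for S :: "'a \<Rightarrow> 'a" and n
    by (induction n) (simp_all add: linear_add[OF that])
  then show ?thesis by (simp add: op_powi_def linear linear_inv)
qed

lemma op_powi_scale: "op_powi T k (a *\<^sub>R x) = a *\<^sub>R op_powi T k x"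
proof -
  have "(S ^^ n) (a *\<^sub>R x) = a *\<^sub>R (S ^^ n) x" if "linear S" for S :: "'a \<Rightarrow> 'a" and n
    by (induction n) (simp_all add: linear_scale[OF that])
  then show ?thesis by (simp add: op_powi_def linear linear_inv)
qed

lemma op_powi_adjoint: "op_powi T k x \<bullet> y = x \<bullet> op_powi T k y"
  by (simp add: op_powi_def selfadjoint_funpow selfadjoint selfadjoint_inv)

lemma op_powi_commute: "op_powi T k (T x) = T (op_powi T k x)"
proof -
  have "(inv T ^^ n) (T x) = T ((inv T ^^ n) x)" for n
    by (induction n) simp_all
  then show ?thesis by (simp add: op_powi_def funpow_swap1)
qed

text \<open>A factor \<open>T ^^ n\<close> absorbs negative powers down to \<open>-n\<close>, which
  turns Laurent polynomials into polynomials.\<close>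

lemma op_powi_funpow:
  assumes "- int n \<le> k"
  shows "op_powi T k ((T ^^ n) z) = (T ^^ nat (k + int n)) z"
proof (cases "0 \<le> k")
  case True
  then have "nat (k + int n) = nat k + n" by simp
  then show ?thesis using True by (simp add: op_powi_def funpow_add)
next
  case False
  have "(inv T ^^ j) ((T ^^ j) w) = w" for j w
    by (induction j arbitrary: w) (simp_all add: funpow_swap1)
  moreover have "n = nat (- k) + nat (k + int n)" using assms False by simp
  ultimately show ?thesis
    using False by (metis (no_types, lifting) comp_apply funpow_add op_powi_def)
qed

lemma linear_laurent_sum: "linear (\<lambda>x. \<Sum>i\<in>I. d i *\<^sub>R op_powi T (h i) x)"
  by (intro linearI) (simp_all add: op_powi_add op_powi_scale sum.distrib scaleR_add_right
      scaleR_sum_right mult.commute)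

lemma selfadjoint_laurent_sum: "selfadjoint_op (\<lambda>x. \<Sum>i\<in>I. d i *\<^sub>R op_powi T (h i) x)"
  by (simp add: selfadjoint_op_def inner_sum_left inner_sum_right op_powi_adjoint)

text \<open>
  With \<open>x = T\<^sup>n z\<close> for large \<open>n\<close>, the form of a Laurent polynomial of \<open>T\<close> at \<open>x\<close> is the form of an
  ordinary polynomial of \<open>T\<close> at \<open>z\<close>.
\<close>

lemma laurent_sum_form_ge:
  fixes h :: "'i \<Rightarrow> int"
  assumes "finite I" and L: "\<And>a. a \<in> {m..M} \<Longrightarrow> L \<le> (\<Sum>i\<in>I. d i * a powi h i)"
  shows "L * (x \<bullet> x) \<le> (\<Sum>i\<in>I. d i *\<^sub>R op_powi T (h i) x) \<bullet> x"
proof -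
  \<comment> \<open>Any \<open>n\<close> that dominates all pole orders would do; their sum is
    one.\<close>
  define n where "n = (\<Sum>i\<in>I. nat (- h i))"
  have n: "- int n \<le> h i" if "i \<in> I" for i
  proof -
    have "nat (- h i) \<le> n"
      unfolding n_def using \<open>finite I\<close> that by (intro member_le_sum) auto
    then show ?thesis by linarith
  qed
  obtain z where x: "x = (T ^^ n) z"
    using surj_fn[OF surj, of n] by (metis surjD)
  define p where "p = (\<Sum>i\<in>I. monom (d i) (nat (h i + int n)))"
  \<comment> \<open>One factor \<open>X^n\<close> of \<open>q\<close> is later moved across the
    inner product by self-adjointness, so that the form of \<open>q(T)\<close> at \<open>z\<close>
    becomes the wanted difference at \<open>x = T^n z\<close>.\<close>
  define q where "q = monom 1 n * (p - monom L n)"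
  have p: "poly_op T p z = (\<Sum>i\<in>I. d i *\<^sub>R op_powi T (h i) x)"
    by (simp add: p_def x poly_op_sum[OF linear] poly_op_monom[OF linear] op_powi_funpow n)
  have "0 \<le> poly q a" if a: "a \<in> {m..M}" for a
  proof -
    have a0: "a > 0" using a m_pos by simp
    have "a ^ nat (h i + int n) = a powi h i * a ^ n" if "i \<in> I" for i
    proof -
      have "a ^ nat (h i + int n) = a powi (h i + int n)"
        using n[OF that] by (simp add: power_int_def)
      then show ?thesis using a0 by (simp add: power_int_add)
    qed
    then have "poly p a = (\<Sum>i\<in>I. d i * (a powi h i * a ^ n))"
      by (simp add: p_def poly_sum poly_monom)
    then have "poly p a = (\<Sum>i\<in>I. d i * a powi h i) * a ^ n"
      by (simp add: sum_distrib_right mult.assoc)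
    moreover have "L * a ^ n \<le> (\<Sum>i\<in>I. d i * a powi h i) * a ^ n"
      using L[OF a] a0 by (intro mult_right_mono) auto
    ultimately show ?thesis
      using a0 by (simp add: q_def poly_monom)
  qed
  then have "0 \<le> poly_op T q z \<bullet> z"
    by (rule poly_op_form_nonneg)
  also have "\<dots> = poly_op T p z \<bullet> x - L * (x \<bullet> x)"
    by (simp add: q_def x poly_op_mult[OF linear] poly_op_diff[OF linear] poly_op_monom[OF linear]
        selfadjoint_funpow[OF selfadjoint] inner_diff_left)
  finally show ?thesis by (simp add: p)
qed

lemma laurent_sum_form_le:
  fixes h :: "'i \<Rightarrow> int"
  assumes "finite I" and U: "\<And>a. a \<in> {m..M} \<Longrightarrow> (\<Sum>i\<in>I. d i * a powi h i) \<le> U"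
  shows "(\<Sum>i\<in>I. d i *\<^sub>R op_powi T (h i) x) \<bullet> x \<le> U * (x \<bullet> x)"
  using laurent_sum_form_ge[OF \<open>finite I\<close>, of "- U" "\<lambda>i. - d i" h x] U
  by (simp add: sum_negf)

text \<open>The transfer principle: a uniform scalar bound on \<open>{m..M}\<close> bounds the form
  from both sides, hence the norm.\<close>

lemma laurent_sum_norm_le:
  fixes h :: "'i \<Rightarrow> int"
  assumes "finite I" and e: "\<And>a. a \<in> {m..M} \<Longrightarrow> \<bar>\<Sum>i\<in>I. d i * a powi h i\<bar> \<le> e"
  shows "norm (\<Sum>i\<in>I. d i *\<^sub>R op_powi T (h i) x) \<le> e * norm x"
proof (rule norm_le_of_abs_form_le[OF linear_laurent_sum selfadjoint_laurent_sum])
  fix x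
  have "- e \<le> (\<Sum>i\<in>I. d i * a powi h i)" "(\<Sum>i\<in>I. d i * a powi h i) \<le> e"
    if "a \<in> {m..M}" for a
    using e[OF that] by linarith+
  then show "\<bar>(\<Sum>i\<in>I. d i *\<^sub>R op_powi T (h i) x) \<bullet> x\<bar> \<le> e * (x \<bullet> x)"
    using laurent_sum_form_ge[OF \<open>finite I\<close>, of "- e" d h x]
      laurent_sum_form_le[OF \<open>finite I\<close>, of d h e x]
    by (simp add: abs_le_iff)
next
  show "0 \<le> e" using e[of m] m_le_M by auto
qed

text \<open>Uniformly small scalar blocks give small operator blocks, so the partial sums are Cauchy
  and completeness applies. The exponents \<open>h\<close> cover both halves of a Laurent
  series.\<close>

lemma summable_laurent_op:
  fixes h :: "nat \<Rightarrow> int"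
  assumes "uniformly_Cauchy_series_on {m..M} (\<lambda>k a. d k * a powi h k)"
  shows "summable (\<lambda>k. d k *\<^sub>R op_powi T (h k) x)"
  unfolding summable_iff_convergent Cauchy_convergent_iff[symmetric]
proof (rule CauchyI')
  fix e :: real assume e: "0 < e"
  \<comment> \<open>The summand 1 avoids a division by zero at \<open>x = 0\<close>.\<close>
  define e' where "e' = e / (norm x + 1)"
  have e': "0 < e'" using e by (simp add: e'_def add_nonneg_pos)
  then obtain N where N: "\<And>i n a. \<lbrakk>N \<le> i; a \<in> {m..M}\<rbrakk> \<Longrightarrow> \<bar>\<Sum>k=i..<n. d k * a powi h k\<bar> \<le> e'"
    using assms unfolding uniformly_Cauchy_series_on_def by metis
  have "dist (\<Sum>k<i. d k *\<^sub>R op_powi T (h k) x) (\<Sum>k<n. d k *\<^sub>R op_powi T (h k) x) < e"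
    if "N \<le> i" "i < n" for i n
  proof -
    have "(\<Sum>k<n. d k *\<^sub>R op_powi T (h k) x) - (\<Sum>k<i. d k *\<^sub>R op_powi T (h k) x)
        = (\<Sum>k=i..<n. d k *\<^sub>R op_powi T (h k) x)"
      using sum_diff_nat_ivl[of 0 i n "\<lambda>k. d k *\<^sub>R op_powi T (h k) x"] that
      by (simp add: atLeast0LessThan)
    then have "dist (\<Sum>k<i. d k *\<^sub>R op_powi T (h k) x) (\<Sum>k<n. d k *\<^sub>R op_powi T (h k) x)
        = norm (\<Sum>k=i..<n. d k *\<^sub>R op_powi T (h k) x)"
      by (subst dist_commute) (simp only: dist_norm)
    also
    have "\<dots> \<le> e' * norm x"
      using N[OF that(1)] by (intro laurent_sum_norm_le) auto
    also have "\<dots> < e' * (norm x + 1)" using e' by simp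
    also have "\<dots> = e" by (simp add: e'_def add_nonneg_eq_0_iff)
    finally show ?thesis .
  qed
  then show "\<exists>N. \<forall>i\<ge>N. \<forall>n>i. dist (\<Sum>k<i. d k *\<^sub>R op_powi T (h k) x)
      (\<Sum>k<n. d k *\<^sub>R op_powi T (h k) x) < e"
    by blast
qed

end

text \<open>
  Two copies of the natural numbers index the nonnegative and the negative exponents, so that a
  symmetric partial sum of a two-sided series becomes a single finite sum.
\<close>

abbreviation laurent_index :: "nat + nat \<Rightarrow> int" where
  "laurent_index \<equiv> case_sum int (\<lambda>k. - int (Suc k))"

lemma bisums_imp_sums:
  assumes "bisums f s"
  shows "(\<lambda>k. f (int k)) sums (\<Sum>k. f (int k))"
    and "(\<lambda>k. f (- int (Suc k))) sums (\<Sum>k. f (- int (Suc k)))"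
    and "s = (\<Sum>k. f (int k)) + (\<Sum>k. f (- int (Suc k)))"
proof -
  obtain s1 s2 where s: "(\<lambda>k. f (int k)) sums s1" "(\<lambda>k. f (- int (Suc k))) sums s2"
    "s = s1 + s2"
    using assms unfolding bisums_def by blast
  note u = sums_unique[OF s(1)] sums_unique[OF s(2)]
  show "(\<lambda>k. f (int k)) sums (\<Sum>k. f (int k))"
    using s(1) unfolding u(1) .
  show "(\<lambda>k. f (- int (Suc k))) sums (\<Sum>k. f (- int (Suc k)))"
    using s(2) unfolding u(2) .
  show "s = (\<Sum>k. f (int k)) + (\<Sum>k. f (- int (Suc k)))"
    using s(3) unfolding u .
qed

section \<open>The operator P(T) as a limit of Laurent polynomials\<close>

locale laurent_operator = positive_definite_bounds T m M
  for T :: "'a::{real_inner, complete_space} \<Rightarrow> 'a" and m M +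
  fixes c :: "int \<Rightarrow> real" and P :: "real \<Rightarrow> real"
  assumes bisums: "\<And>a. a \<in> {m..M} \<Longrightarrow> bisums (\<lambda>k. c k * a powi k) (P a)"
begin

definition partial :: "nat \<Rightarrow> 'a \<Rightarrow> 'a" where
  "partial n x = (\<Sum>i\<in>{..<n} <+> {..<n}. c (laurent_index i)
     *\<^sub>R op_powi T (laurent_index i) x)"

lemma powi_neg_Suc: "(a::real) powi (- int (Suc k)) = inverse (a ^ Suc k)"
  unfolding power_int_minus power_int_of_nat ..

text \<open>The nonnegative half is controlled by its convergence at \<open>M\<close>, the negative
  half by its convergence at \<open>m\<close>.\<close>

lemma uniformly_Cauchy_halves:
  "uniformly_Cauchy_series_on {m..M} (\<lambda>k a. c (int k) * a powi int k)"
  "uniformly_Cauchy_series_on {m..M} (\<lambda>k a. c (- int (Suc k)) * a powi (- int (Suc k)))"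
proof -
  have "summable (\<lambda>k. c (int k) * M ^ k)"
    using sums_summable[OF bisums_imp_sums(1)[OF bisums[of M]]] m_le_M by simp
  then show "uniformly_Cauchy_series_on {m..M} (\<lambda>k a. c (int k) * a powi int k)"
    using uniformly_Cauchy_power_series[OF m_pos m_le_M, of "\<lambda>k. c (int k)"] by simp
  have "summable (\<lambda>k. c (- int (Suc k)) * inverse (m ^ Suc k))"
    using sums_summable[OF bisums_imp_sums(2)[OF bisums[of m]]] m_le_M
    unfolding powi_neg_Suc by simp
  then show "uniformly_Cauchy_series_on {m..M} (\<lambda>k a. c (- int (Suc k)) * a powi (- int (Suc k)))"
    unfolding powi_neg_Suc by (rule uniformly_Cauchy_inverse_power_series[OF m_pos])
qed

lemma partial_tendsto: "(\<lambda>n. partial n x) \<longlonglongrightarrow> laurent_op c T x"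
proof -
  have "(\<lambda>n. (\<Sum>k<n. c (int k) *\<^sub>R op_powi T (int k) x)
      + (\<Sum>k<n. c (- int (Suc k)) *\<^sub>R op_powi T (- int (Suc k)) x)) \<longlonglongrightarrow> laurent_op c T x"
    unfolding laurent_op_def bisum_def
    by (intro tendsto_add summable_LIMSEQ summable_laurent_op uniformly_Cauchy_halves)
  then show ?thesis
    unfolding partial_def by (simp add: sum.Plus del: of_nat_Suc)
qed

lemma scalar_partial_close:
  assumes "0 < e"
  obtains n where "\<And>i a. \<lbrakk>n \<le> i; a \<in> {m..M}\<rbrakk> \<Longrightarrow>
    \<bar>P a - (\<Sum>i\<in>{..<i} <+> {..<i}. c (laurent_index i)
       * a powi (laurent_index i))\<bar> \<le> e"
proof -
  define s1 where "s1 a = (\<Sum>k. c (int k) * a powi int k)" for a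
  define s2 where "s2 a = (\<Sum>k. c (- int (Suc k)) * a powi (- int (Suc k)))" for a
  have s: "(\<lambda>k. c (int k) * a powi int k) sums s1 a"
    "(\<lambda>k. c (- int (Suc k)) * a powi (- int (Suc k))) sums s2 a"
    "P a = s1 a + s2 a" if "a \<in> {m..M}" for a
    unfolding s1_def s2_def by (fact bisums_imp_sums[OF bisums[OF that]])+
  have e2: "0 < e / 2" using assms by simp
  obtain N1 where N1: "\<And>i a. \<lbrakk>N1 \<le> i; a \<in> {m..M}\<rbrakk> \<Longrightarrow>
      \<bar>s1 a - (\<Sum>k<i. c (int k) * a powi int k)\<bar> \<le> e / 2"
    using uniformly_Cauchy_series_on_remainder[OF uniformly_Cauchy_halves(1) s(1) e2] by blast
  obtain N2 where N2: "\<And>i a. \<lbrakk>N2 \<le> i; a \<in> {m..M}\<rbrakk> \<Longrightarrow>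
      \<bar>s2 a - (\<Sum>k<i. c (- int (Suc k)) * a powi (- int (Suc k)))\<bar> \<le> e / 2"
    using uniformly_Cauchy_series_on_remainder[OF uniformly_Cauchy_halves(2) s(2) e2] by blast
  have "\<bar>P a - (\<Sum>i\<in>{..<i} <+> {..<i}. c (laurent_index i)
       * a powi (laurent_index i))\<bar> \<le> e"
    if "max N1 N2 \<le> i" "a \<in> {m..M}" for i a
  proof -
    have "(\<Sum>i\<in>{..<i} <+> {..<i}. c (laurent_index i)
       * a powi (laurent_index i))
      = (\<Sum>k<i. c (int k) * a powi int k) + (\<Sum>k<i. c (- int (Suc k)) * a powi (- int (Suc k)))"
      by (simp add: sum.Plus del: of_nat_Suc)
    moreover have "N1 \<le> i" "N2 \<le> i" using that by simp_all
    ultimately show ?thesis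
      using N1[OF _ that(2), of i] N2[OF _ that(2), of i] s(3)[OF that(2)] by linarith
  qed
  then show thesis using that by blast
qed

lemma linear_partial: "linear (partial n)"
  unfolding partial_def by (rule linear_laurent_sum)

text \<open>Linearity, and below self-adjointness and commutation with \<open>T\<close>, pass from
  the partial sums to their pointwise limit.\<close>

lemma linear_laurent_op: "linear (laurent_op c T)"
proof (rule linearI)
  show "laurent_op c T (x + y) = laurent_op c T x + laurent_op c T y" for x y
    using tendsto_add[OF partial_tendsto partial_tendsto, of x y] partial_tendsto[of "x + y"]
    by (simp add: linear_add[OF linear_partial] LIMSEQ_unique)
  show "laurent_op c T (a *\<^sub>R x) = a *\<^sub>R laurent_op c T x" for a x
    using tendsto_scaleR[OF tendsto_const partial_tendsto, of a x] partial_tendsto[of "a *\<^sub>R x"]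
    by (simp add: linear_scale[OF linear_partial] LIMSEQ_unique)
qed

lemma selfadjoint_laurent_op: "selfadjoint_op (laurent_op c T)"
  unfolding selfadjoint_op_def
proof safe
  fix x y
  have "partial n x \<bullet> y = x \<bullet> partial n y" for n
    unfolding partial_def by (rule selfadjoint_laurent_sum[unfolded selfadjoint_op_def, rule_format])
  then show "laurent_op c T x \<bullet> y = x \<bullet> laurent_op c T y"
    using tendsto_inner[OF partial_tendsto tendsto_const, of x y]
      tendsto_inner[OF tendsto_const partial_tendsto, of x y]
    by (simp add: LIMSEQ_unique)
qed

lemma laurent_op_commute: "laurent_op c T (T x) = T (laurent_op c T x)"
proof -
  have "partial n (T x) = T (partial n x)" for n
    by (simp add: partial_def op_powi_commute linear_sum[OF linear] linear_scale[OF linear])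
  then show ?thesis
    using bounded_linear.tendsto[OF bounded_linear partial_tendsto, of x] partial_tendsto[of "T x"]
    by (simp add: LIMSEQ_unique)
qed

text \<open>The slack \<open>e\<close> is the uniform distance between \<open>P\<close> and its late
  scalar partial sums; the resulting form bounds on \<open>partial\<close> survive the
  limit.\<close>

lemma laurent_op_form_bounds:
  assumes "0 < e" and LU: "\<And>a. a \<in> {m..M} \<Longrightarrow> L \<le> P a \<and> P a \<le> U"
  shows "(L - e) * (x \<bullet> x) \<le> laurent_op c T x \<bullet> x"
    and "laurent_op c T x \<bullet> x \<le> (U + e) * (x \<bullet> x)"
proof -
  obtain n where n: "\<And>i a. \<lbrakk>n \<le> i; a \<in> {m..M}\<rbrakk> \<Longrightarrow>
    \<bar>P a - (\<Sum>i\<in>{..<i} <+> {..<i}. c (laurent_index i)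
       * a powi (laurent_index i))\<bar> \<le> e"
    using scalar_partial_close[OF \<open>0 < e\<close>] by blast
  have lim: "(\<lambda>i. partial i x \<bullet> x) \<longlonglongrightarrow> laurent_op c T x \<bullet> x"
    by (intro tendsto_inner partial_tendsto tendsto_const)
  have ge: "(L - e) * (x \<bullet> x) \<le> partial i x \<bullet> x" if "n \<le> i" for i
    unfolding partial_def
  proof (rule laurent_sum_form_ge)
    fix a assume a: "a \<in> {m..M}"
    then show "L - e \<le> (\<Sum>i\<in>{..<i} <+> {..<i}. c (laurent_index i)
       * a powi (laurent_index i))"
      using n[OF that a] LU[OF a] by linarith
  qed simp
  have le: "partial i x \<bullet> x \<le> (U + e) * (x \<bullet> x)" if "n \<le> i" for i
    unfolding partial_def
  proof (rule laurent_sum_form_le)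
    fix a assume a: "a \<in> {m..M}"
    then show "(\<Sum>i\<in>{..<i} <+> {..<i}. c (laurent_index i)
       * a powi (laurent_index i)) \<le> U + e"
      using n[OF that a] LU[OF a] by linarith
  qed simp
  show "(L - e) * (x \<bullet> x) \<le> laurent_op c T x \<bullet> x"
    using ge by (intro LIMSEQ_le_const[OF lim]) blast
  show "laurent_op c T x \<bullet> x \<le> (U + e) * (x \<bullet> x)"
    using le by (intro LIMSEQ_le_const2[OF lim]) blast
qed

end

text \<open>Boundedness of \<open>W\<close> makes the infimum and supremum over the unit sphere
  genuine bounds; a nonzero \<open>x\<close> is then normalised. At \<open>x = 0\<close>, the only
  point if the sphere is empty, all terms vanish.\<close>

lemma bounded_op_form_bounds:
  assumes "bounded_linear W"
  shows lower_bound_op_form: "lower_bound_op W * (x \<bullet> x) \<le> W x \<bullet> x"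
    and upper_bound_op_form: "W x \<bullet> x \<le> upper_bound_op W * (x \<bullet> x)"
proof -
  obtain K where K: "\<And>x. \<bar>W x \<bullet> x\<bar> \<le> K * (x \<bullet> x)"
    using form_le_of_bounded[OF assms] by blast
  have lin: "linear W"
    by (rule bounded_linear.linear[OF assms])
  have bd: "\<bar>W u \<bullet> u\<bar> \<le> K" if "norm u = 1" for u
    using K[of u] that by (simp add: power2_norm_eq_inner[symmetric])
  have below: "bdd_below ((\<lambda>u. W u \<bullet> u) ` {u. norm u = 1})"
    using bd by (intro bdd_belowI2[of _ "- K"]) (force simp: abs_le_iff)
  have above: "bdd_above ((\<lambda>u. W u \<bullet> u) ` {u. norm u = 1})"
    using bd by (intro bdd_aboveI2[of _ _ K]) (auto dest: abs_le_D1)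
  have "lower_bound_op W * (x \<bullet> x) \<le> W x \<bullet> x \<and> W x \<bullet> x \<le> upper_bound_op W * (x \<bullet> x)"
  proof (cases "x = 0")
    case False
    define u where "u = (1 / norm x) *\<^sub>R x"
    have u: "u \<in> {u. norm u = 1}"
      using False by (simp add: u_def)
    have form: "W u \<bullet> u = (W x \<bullet> x) / (x \<bullet> x)"
      by (simp add: u_def linear_scale[OF lin] power2_norm_eq_inner[symmetric] power2_eq_square)
    have x0: "x \<bullet> x > 0" using False by simp
    have "lower_bound_op W \<le> W u \<bullet> u"
      unfolding lower_bound_op_def by (rule cINF_lower[OF below u])
    moreover have "W u \<bullet> u \<le> upper_bound_op W"
      unfolding upper_bound_op_def by (rule cSUP_upper[OF u above])
    ultimately show ?thesis
      unfolding form using x0 by (simp add: field_simps)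
  qed simp
  then show "lower_bound_op W * (x \<bullet> x) \<le> W x \<bullet> x"
    and "W x \<bullet> x \<le> upper_bound_op W * (x \<bullet> x)" by blast+
qed

section \<open>Limits of geometric means\<close>

text \<open>
  The hypotheses say that the ratios of successive terms increase and are at most \<open>1\<close>, hence so do
  their geometric means.
\<close>

lemma root_convergent_of_log_convex:
  fixes e :: "nat \<Rightarrow> real"
  assumes pos: "\<And>k. 0 < e k" and dec: "\<And>k. e (Suc k) \<le> e k"
    and convex: "\<And>k. (e (Suc k))\<^sup>2 \<le> e k * e (Suc (Suc k))"
  shows "convergent (\<lambda>n. root n (e n / e 0))"
proof -
  define q where "q k = e (Suc k) / e k" for k
  define p where "p n = e n / e 0" for n
  have q0: "0 < q k" for k
    using pos by (simp add: q_def)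
  have p0: "0 < p n" for n
    using pos by (simp add: p_def)
  have "q k \<le> q (Suc k)" for k
    using convex[of k] pos[of k] pos[of "Suc k"]
    by (simp add: q_def field_simps power2_eq_square)
  then have q_mono: "q k \<le> q l" if "k \<le> l" for k l
    using that by (rule lift_Suc_mono_le)
  have p_Suc: "p (Suc n) = p n * q n" for n
    using pos[of n] by (simp add: p_def q_def)
  \<comment> \<open>\<open>p n\<close> is the product of \<open>q 0\<close> to
    \<open>q (n - 1)\<close>, and each of these is at most \<open>q n\<close>.\<close>
  have p_le: "p n \<le> q n ^ n" for n
  proof (induction n)
    case 0
    then show ?case using pos[of 0] by (simp add: p_def)
  next
    case (Suc n)
    have "p (Suc n) \<le> q n ^ n * q n"
      unfolding p_Suc using Suc.IH q0[of n] by (intro mult_right_mono) auto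
    also have "\<dots> = q n ^ Suc n" by simp
    also have "\<dots> \<le> q (Suc n) ^ Suc n"
      using q_mono[of n "Suc n"] q0[of n] by (intro power_mono) auto
    finally show ?case .
  qed
  \<comment> \<open>The geometric mean \<open>s\<close> is at most the next factor
    \<open>q n\<close>, so including that factor cannot lower the mean.\<close>
  have mono: "root n (p n) \<le> root (Suc n) (p (Suc n))" if n: "0 < n" for n
  proof -
    define s where "s = root n (p n)"
    have s0: "0 \<le> s" and sn: "s ^ n = p n"
      using p0[of n] n by (simp_all add: s_def)
    have "s \<le> root n (q n ^ n)"
      unfolding s_def using p_le n by simp
    then have "s \<le> q n"
      using n q0[of n] by (simp add: real_root_power_cancel)
    then have "s ^ n * s \<le> s ^ n * q n"
      using s0 by (intro mult_left_mono) auto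
    then have "s ^ Suc n \<le> p (Suc n)"
      unfolding p_Suc sn[symmetric] by (simp add: mult.commute)
    then have "root (Suc n) (s ^ Suc n) \<le> root (Suc n) (p (Suc n))"
      by (simp del: power_Suc)
    then show ?thesis
      using s0 by (simp add: real_root_power_cancel s_def[symmetric] del: power_Suc)
  qed
  have p_le1: "p n \<le> 1" for n
  proof -
    have "e n \<le> e 0"
      using lift_Suc_antimono_le[of e, OF dec] by blast
    then show ?thesis using pos[of 0] by (simp add: p_def)
  qed
  \<comment> \<open>The sequence is shifted because \<open>root 0\<close> has the default value 0,
    which is not a geometric mean.\<close>
  have "incseq (\<lambda>n. root (Suc n) (p (Suc n)))"
    using mono by (intro incseq_SucI) simp
  moreover have "root (Suc n) (p (Suc n)) \<le> 1" for n
    using p_le1 by simp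
  ultimately obtain L where "(\<lambda>n. root (Suc n) (p (Suc n))) \<longlonglongrightarrow> L"
    using incseq_convergent[of "\<lambda>n. root (Suc n) (p (Suc n))" 1] by blast
  then have "(\<lambda>n. root n (p n)) \<longlonglongrightarrow> L"
    by (rule LIMSEQ_imp_Suc)
  then show ?thesis
    unfolding p_def convergent_def by blast
qed

lemma root_tendsto_1_of_bounded:
  fixes q :: "nat \<Rightarrow> real"
  assumes "0 < a" and "\<And>n. a \<le> q n" "\<And>n. q n \<le> b"
  shows "(\<lambda>n. root n (q n)) \<longlonglongrightarrow> 1"
proof (rule tendsto_sandwich)
  have "0 < b" using assms(1) assms(2,3)[of 0] by linarith
  then show "(\<lambda>n. root n a) \<longlonglongrightarrow> 1" "(\<lambda>n. root n b) \<longlonglongrightarrow> 1"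
    using \<open>0 < a\<close> by (auto intro: LIMSEQ_root_const)
  show "\<forall>\<^sub>F n in sequentially. root n a \<le> root n (q n)"
    using assms by (intro eventually_sequentiallyI[of 1]) simp
  show "\<forall>\<^sub>F n in sequentially. root n (q n) \<le> root n b"
    using assms by (intro eventually_sequentiallyI[of 1]) simp
qed

lemma prod_rate:
  assumes "\<And>k. V (g k) \<bullet> g k \<noteq> 0"
  shows "(\<Prod>k<n. rate V g k) = (V (g n) \<bullet> g n) / (V (g 0) \<bullet> g 0)"
proof -
  have "g k \<noteq> 0" for k
    using assms[of k] by auto
  then show ?thesis
    using assms by (induction n) (simp_all add: rate_def)
qed

lemma root_prod_rate_tendsto_transfer:
  fixes V Q :: "'a::real_inner \<Rightarrow> 'a"
  assumes g: "\<And>k. g k \<noteq> 0"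
    and V: "0 < a" "\<And>x. a * (x \<bullet> x) \<le> V x \<bullet> x" "\<And>x. V x \<bullet> x \<le> b * (x \<bullet> x)"
    and Q: "0 < L" "\<And>x. L * (x \<bullet> x) \<le> Q x \<bullet> x" "\<And>x. Q x \<bullet> x \<le> U * (x \<bullet> x)"
    and lim: "(\<lambda>n. root n (\<Prod>k<n. rate Q g k)) \<longlonglongrightarrow> r"
  shows "(\<lambda>n. root n (\<Prod>k<n. rate V g k)) \<longlonglongrightarrow> r"
proof -
  have gg: "0 < g k \<bullet> g k" for k
    using g by simp
  define v where "v k = V (g k) \<bullet> g k" for k
  define e where "e k = Q (g k) \<bullet> g k" for k
  have v: "0 < v k" "a * (g k \<bullet> g k) \<le> v k" "v k \<le> b * (g k \<bullet> g k)" for k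
    using V(2,3)[of "g k"] mult_pos_pos[OF V(1) gg[of k]] by (auto simp: v_def)
  have e: "0 < e k" "L * (g k \<bullet> g k) \<le> e k" "e k \<le> U * (g k \<bullet> g k)" for k
    using Q(2,3)[of "g k"] mult_pos_pos[OF Q(1) gg[of k]] by (auto simp: e_def)
  have U: "0 < U"
    using less_le_trans[OF e(1) e(3)] gg by (rule zero_less_mult_pos2)
  have b: "0 < b"
    using less_le_trans[OF v(1) v(3)] gg by (rule zero_less_mult_pos2)
  \<comment> \<open>The quotient of the two telescoped products. Comparing both forms with
    \<open>g n \<bullet> g n\<close> confines it between positive constants.\<close>
  define q where "q n = (v n / e n) * (e 0 / v 0)" for n
  have "(\<lambda>n. root n (q n)) \<longlonglongrightarrow> 1"
  proof (rule root_tendsto_1_of_bounded)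
    show "0 < a / U * (e 0 / v 0)"
      using U V(1) e(1) v(1) by simp
    show "a / U * (e 0 / v 0) \<le> q n" for n
      unfolding q_def
    proof (rule mult_right_mono)
      have "a / U = (a * (g n \<bullet> g n)) / (U * (g n \<bullet> g n))"
        using gg[of n] by simp
      also have "\<dots> \<le> v n / e n"
        using v[of n] e[of n] gg[of n] V(1) by (intro frac_le) auto
      finally show "a / U \<le> v n / e n" .
    qed (use e(1)[of 0] v(1)[of 0] in simp)
    show "q n \<le> b / L * (e 0 / v 0)" for n
      unfolding q_def
    proof (rule mult_right_mono)
      have "v n / e n \<le> (b * (g n \<bullet> g n)) / (L * (g n \<bullet> g n))"
        using v[of n] e[of n] gg[of n] Q(1) b by (intro frac_le) auto
      also have "\<dots> = b / L"
        using gg[of n] by simp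
      finally show "v n / e n \<le> b / L" .
    qed (use e(1)[of 0] v(1)[of 0] in simp)
  qed
  then have "(\<lambda>n. root n (\<Prod>k<n. rate Q g k) * root n (q n)) \<longlonglongrightarrow> r * 1"
    by (rule tendsto_mult[OF lim])
  moreover have "root n (\<Prod>k<n. rate Q g k) * root n (q n) = root n (\<Prod>k<n. rate V g k)" for n
  proof -
    have "(\<Prod>k<n. rate V g k) = v n / v 0" "(\<Prod>k<n. rate Q g k) = e n / e 0"
      using prod_rate[of V g n] prod_rate[of Q g n] v(1) e(1)
      unfolding v_def e_def by (auto simp: less_le)
    then have "(\<Prod>k<n. rate V g k) = (\<Prod>k<n. rate Q g k) * q n"
      using e(1)[of n] e(1)[of 0] by (simp add: q_def)
    then show ?thesis by (simp add: real_root_mult)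
  qed
  ultimately show ?thesis by simp
qed

text \<open>If the gradient vanishes at the start, all rates have their default value 1. Otherwise
  the step that first reaches 0 has rate 0 and annihilates every later product. Either limit is the
  same for all \<open>V\<close>.\<close>

lemma root_prod_rate_tendsto_of_zero:
  assumes zero: "g k = 0" and stay: "\<And>k. g k = 0 \<Longrightarrow> g (Suc k) = 0"
  shows "(\<lambda>n. root n (\<Prod>k<n. rate V g k)) \<longlonglongrightarrow> (if g 0 = 0 then 1 else 0)"
proof (cases "g 0 = 0")
  case True
  have "g j = 0" for j
    by (induction j) (simp_all add: True stay)
  then have "rate V g = (\<lambda>_. 1)"
    by (simp add: rate_def fun_eq_iff)
  then have "\<forall>\<^sub>F n in sequentially. root n (\<Prod>k<n. rate V g k) = 1"
    by (intro eventually_sequentiallyI[of 1]) simp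
  then show ?thesis
    using True by (simp add: tendsto_eventually)
next
  case False
  define l where "l = (LEAST k. g k = 0)"
  have l: "g l = 0"
    unfolding l_def by (rule LeastI[of "\<lambda>k. g k = 0", OF zero])
  then obtain j where j: "l = Suc j"
    using False by (metis not0_implies_Suc)
  then have "g j \<noteq> 0"
    using not_less_Least[of j "\<lambda>k. g k = 0"] by (simp add: l_def)
  then have "rate V g j = 0"
    using l j by (simp add: rate_def)
  then have "(\<Prod>k<n. rate V g k) = 0" if "n \<ge> l" for n
    using that j by (intro prod_zero) (auto intro!: bexI[of _ j])
  then have "\<forall>\<^sub>F n in sequentially. root n (\<Prod>k<n. rate V g k) = 0"
    by (intro eventually_sequentiallyI[of l]) (simp only: real_root_zero)
  then show ?thesis
    using False by (simp add: tendsto_eventually)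
qed

section \<open>The gradient iteration\<close>

text \<open>The algorithm seen through its gradients: \<open>T\<close> stands for \<open>A\<close>,
  \<open>Q\<close> for \<open>P(A)\<close>, and the iterates themselves have been
  eliminated.\<close>

locale gradient_step =
  fixes T Q :: "'a::real_inner \<Rightarrow> 'a" and L U :: real and g :: "nat \<Rightarrow> 'a"
  assumes T: "linear T" "selfadjoint_op T" "inj T"
    and Q: "linear Q" "selfadjoint_op Q"
    and commute: "\<And>x. Q (T x) = T (Q x)"
    and L_pos: "0 < L" and Q_ge: "\<And>x. L * (x \<bullet> x) \<le> Q x \<bullet> x"
    and Q_le: "\<And>x. Q x \<bullet> x \<le> U * (x \<bullet> x)"
    and step: "\<And>k. g (Suc k) = (if g k = 0 then 0 else g k - step_length Q T (g k) *\<^sub>R T (g k))"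
begin

lemma Q_pos: "x \<noteq> 0 \<Longrightarrow> 0 < Q x \<bullet> x"
  using Q_ge[of x] L_pos by (smt (verit) inner_gt_zero_iff mult_pos_pos)

lemma Q_sym: "Q x \<bullet> y = Q y \<bullet> x"
  using Q(2) by (metis selfadjoint_op_def inner_commute)

lemma QT_sym: "Q (T x) \<bullet> y = Q x \<bullet> T y"
  using T(2) commute by (simp add: selfadjoint_op_def)

lemma step_orthogonal: "Q (g (Suc k)) \<bullet> T (g k) = 0"
proof (cases "g k = 0")
  case False
  \<comment> \<open>Injectivity keeps the denominator of the step length positive.\<close>
  have "T (g k) \<noteq> 0"
    using False injD[OF T(3), of "g k" 0] linear_0[OF T(1)] by auto
  then have "0 < Q (T (g k)) \<bullet> T (g k)"
    by (rule Q_pos)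
  moreover have "step_length Q T (g k) = (Q (g k) \<bullet> T (g k)) / (Q (T (g k)) \<bullet> T (g k))"
    by (simp add: step_length_def QT_sym)
  ultimately show ?thesis
    using False by (simp add: step linear_diff[OF Q(1)] linear_scale[OF Q(1)] inner_diff_left)
qed (simp add: step linear_0[OF Q(1)])

lemma energy_Suc: "Q (g (Suc k)) \<bullet> g (Suc k) = Q (g (Suc k)) \<bullet> g k"
proof (cases "g k = 0")
  case False
  have "Q (g (Suc k)) \<bullet> g (Suc k)
      = Q (g (Suc k)) \<bullet> g k - step_length Q T (g k) * (Q (g (Suc k)) \<bullet> T (g k))"
    using False by (subst (2) step) (simp add: inner_diff_right)
  then show ?thesis by (simp add: step_orthogonal)
qed (simp add: step)

text \<open>The correction in step \<open>k + 1\<close> pairs \<open>T (g (Suc k))\<close> with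
  \<open>g k\<close>. Moving \<open>T\<close> across turns it into the product that already vanishes
  by the orthogonality of step \<open>k\<close>.\<close>

lemma energy_Suc_Suc: "Q (g (Suc (Suc k))) \<bullet> g k = Q (g (Suc k)) \<bullet> g (Suc k)"
proof (cases "g (Suc k) = 0")
  case True
  then have "g (Suc (Suc k)) = 0"
    by (subst step) simp
  then show ?thesis using True by (simp add: linear_0[OF Q(1)])
next
  case False
  have "Q (g (Suc (Suc k))) \<bullet> g k
      = Q (g (Suc k)) \<bullet> g k - step_length Q T (g (Suc k)) * (Q (g (Suc k)) \<bullet> T (g k))"
    using False
    by (subst step) (simp add: inner_diff_left linear_diff[OF Q(1)] linear_scale[OF Q(1)] QT_sym)
  then show ?thesis by (simp add: step_orthogonal energy_Suc)
qed

lemma positive_Q: "positive_op Q"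
  unfolding positive_op_def by (metis Q_pos inner_zero_right less_imp_le order_refl)

lemma energy_log_convex:
  "(Q (g (Suc k)) \<bullet> g (Suc k))\<^sup>2 \<le> (Q (g k) \<bullet> g k) * (Q (g (Suc (Suc k))) \<bullet> g (Suc (Suc k)))"
  using selfadjoint_cauchy_schwarz[OF Q positive_Q, of "g (Suc (Suc k))" "g k"]
  unfolding energy_Suc_Suc by (simp add: mult.commute)

text \<open>Pythagoras: by \<open>energy_Suc\<close> the energy of the difference of two successive
  gradients equals the drop in energy.\<close>

lemma energy_decreasing: "Q (g (Suc k)) \<bullet> g (Suc k) \<le> Q (g k) \<bullet> g k"
proof -
  have "0 \<le> Q (g (Suc k) - g k) \<bullet> (g (Suc k) - g k)"
    using positive_Q by (simp add: positive_op_def)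
  also have "\<dots> = Q (g k) \<bullet> g k - Q (g (Suc k)) \<bullet> g (Suc k)"
    using energy_Suc[of k] Q_sym[of "g k" "g (Suc k)"]
    by (simp add: linear_diff[OF Q(1)] inner_diff_left inner_diff_right)
  finally show ?thesis by simp
qed

text \<open>Choosing \<open>r\<close> before \<open>V\<close> expresses that the limit does not
  depend on the operator in the rate.\<close>

lemma common_root_rate_limit:
  "\<exists>r. \<forall>V a b. 0 < a \<and> (\<forall>x. a * (x \<bullet> x) \<le> V x \<bullet> x \<and> V x \<bullet> x \<le> b * (x \<bullet> x)) \<longrightarrow>
     (\<lambda>n. root n (\<Prod>k<n. rate V g k)) \<longlonglongrightarrow> r"
proof (cases "\<exists>k. g k = 0")
  case True
  then obtain k where k: "g k = 0" by blast
  have "(\<lambda>n. root n (\<Prod>k<n. rate V g k)) \<longlonglongrightarrow> (if g 0 = 0 then 1 else 0)" for V :: "'a \<Rightarrow> 'a"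
    by (rule root_prod_rate_tendsto_of_zero[of g k V, OF k]) (simp add: step)
  then show ?thesis by blast
next
  case False
  then have pos: "0 < Q (g k) \<bullet> g k" for k
    by (simp add: Q_pos)
  have "convergent (\<lambda>n. root n ((Q (g n) \<bullet> g n) / (Q (g 0) \<bullet> g 0)))"
    by (rule root_convergent_of_log_convex[where e = "\<lambda>k. Q (g k) \<bullet> g k",
        OF pos energy_decreasing energy_log_convex])
  then obtain r where "(\<lambda>n. root n ((Q (g n) \<bullet> g n) / (Q (g 0) \<bullet> g 0))) \<longlonglongrightarrow> r"
    by (auto simp: convergent_def)
  then have "(\<lambda>n. root n (\<Prod>k<n. rate Q g k)) \<longlonglongrightarrow> r"
    using pos by (subst prod_rate) (auto simp: less_le)
  then show ?thesis
    using False L_pos Q_ge Q_le root_prod_rate_tendsto_transfer[of g _ _ _ L Q U r] by blast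
qed

end

section \<open>The minimiser of the objective and the common rate\<close>

lemma quadratic_objective_arg_min:
  assumes A: "linear A" "selfadjoint_op A" "positive_op A"
  shows "is_arg_min (quadratic_objective A (A u)) (\<lambda>_. True) u"
proof -
  \<comment> \<open>Completing the square around \<open>u\<close>: the excess over the value at
    \<open>u\<close> is half the form of \<open>A\<close> at \<open>z - u\<close>.\<close>
  have "quadratic_objective A (A u) z - quadratic_objective A (A u) u = 1/2 * (A (z - u) \<bullet> (z - u))"
    for z
  proof -
    have "A u \<bullet> z = A z \<bullet> u" "z \<bullet> A u = A z \<bullet> u" "u \<bullet> A u = A u \<bullet> u"
      using A(2) by (simp_all add: selfadjoint_op_def inner_commute)
    then show ?thesis
      by (simp add: quadratic_objective_def linear_diff[OF A(1)] inner_diff_left inner_diff_right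
          algebra_simps)
  qed
  moreover have "0 \<le> A (z - u) \<bullet> (z - u)" for z
    using A(3) by (simp add: positive_op_def)
  ultimately have "quadratic_objective A (A u) u \<le> quadratic_objective A (A u) z" for z
    by (metis diff_ge_0_iff_ge mult_nonneg_nonneg zero_le_divide_1_iff zero_le_numeral)
  then show ?thesis
    by (simp add: is_arg_min_def not_less)
qed

lemma grad_gradient_iterate_Suc:
  assumes "linear A"
  shows "grad A y (gradient_iterate Q A y x0 (Suc k)) =
    (let g = grad A y (gradient_iterate Q A y x0 k)
     in if g = 0 then 0 else g - step_length Q A g *\<^sub>R A g)"
  by (simp add: Let_def grad_def linear_diff[OF assms] linear_scale[OF assms])

theorem theorem6:
  fixes A :: "'a::{real_inner, complete_space} \<Rightarrow> 'a"
    and m M :: real and P :: "real \<Rightarrow> real" and c :: "int \<Rightarrow> real"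
  assumes "bounded_linear A" and "selfadjoint_op A" and "positive_op A"
    and "m = lower_bound_op A" and "M = upper_bound_op A" and "0 < m" and "m < M"
    and "infinitely_differentiable_on P {m..M}"
    and "\<forall>a\<in>{m..M}. bisums (\<lambda>k. c k * a powi k) (P a)"
    and "\<forall>a\<in>{m..M}. 0 < P a"
  defines "g \<equiv> \<lambda>y x0 k. grad A y (gradient_iterate (laurent_op c A) A y x0 k)"
  shows "\<exists>R :: 'a \<Rightarrow> 'a \<Rightarrow> real.
    \<forall>x0 xstar y. xstar = inv A y \<longrightarrow>
      is_arg_min (quadratic_objective A y) (\<lambda>_. True) xstar \<and>
      (\<forall>W. bounded_linear W \<and> selfadjoint_op W \<and> positive_op W \<and>
           0 < lower_bound_op W \<and> lower_bound_op W < upper_bound_op W \<and> W \<circ> A = A \<circ> W \<longrightarrow>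
         (\<lambda>n. root n (\<Prod>k<n. rate W (g y x0) k)) \<longlonglongrightarrow> R x0 xstar) \<and>
      (\<lambda>n. root n (\<Prod>k<n. rate (laurent_op c A) (g y x0) k)) \<longlonglongrightarrow> R x0 xstar"
proof -
  interpret positive_definite_bounds A m M
    using assms(1,2,6,7) unfolding assms(4,5)
    by (intro positive_definite_bounds.intro selfadjoint_bounds.intro
        positive_definite_bounds_axioms.intro) (simp_all add: bounded_op_form_bounds)
  interpret laurent_operator A m M c P
    using assms(9) by unfold_locales blast
  let ?Q = "laurent_op c A"
  obtain D where "\<forall>x\<in>{m..M}. D 0 x = P x"
    "\<forall>k. \<forall>x\<in>{m..M}. (D k has_real_derivative D (Suc k) x) (at x within {m..M})"
    using assms(8) unfolding infinitely_differentiable_on_def by blast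
  \<comment> \<open>Continuity on the compact interval makes \<open>P\<close> attain its extrema; as
    \<open>P\<close> is positive there, its minimum is positive.\<close>
  then have "continuous_on {m..M} (D 0)"
    by (intro DERIV_continuous_on[where D = "D (Suc 0)"]) auto
  then have cont: "continuous_on {m..M} P"
    using \<open>\<forall>x\<in>{m..M}. D 0 x = P x\<close> by (subst continuous_on_cong[of _ _ P "D 0"]) auto
  have ne: "{m..M} \<noteq> {}" using m_le_M by simp
  obtain a where a: "a \<in> {m..M}" "\<forall>x\<in>{m..M}. P a \<le> P x"
    using continuous_attains_inf[OF compact_Icc ne cont] by blast
  obtain b where b: "b \<in> {m..M}" "\<forall>x\<in>{m..M}. P x \<le> P b"
    using continuous_attains_sup[OF compact_Icc ne cont] by blast
  \<comment> \<open>Half the minimum of \<open>P\<close>: after giving up the slack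
    \<open>e\<close>, the lower bound of the form is still \<open>e > 0\<close>.\<close>
  define e where "e = P a / 2"
  have e: "0 < e" "P a - e = e"
    using a(1) assms(10) by (auto simp: e_def)
  have Q_ge: "e * (x \<bullet> x) \<le> ?Q x \<bullet> x" and Q_le: "?Q x \<bullet> x \<le> (P b + e) * (x \<bullet> x)" for x
    using laurent_op_form_bounds[OF e(1), of "P a" "P b" x] a(2) b(2) unfolding e(2) by auto
  have "gradient_step A ?Q e (P b + e) (g y x0)" for y x0
  proof (rule gradient_step.intro)
    show "g y x0 (Suc k) = (if g y x0 k = 0 then 0
        else g y x0 k - step_length ?Q A (g y x0 k) *\<^sub>R A (g y x0 k))" for k
      unfolding g_def using grad_gradient_iterate_Suc[OF linear, of y ?Q x0 k]
      by (simp only: Let_def)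
  qed (use e Q_ge Q_le in \<open>simp_all add: linear selfadjoint inj linear_laurent_op
        selfadjoint_laurent_op laurent_op_commute\<close>)
  then have "\<forall>y x0. \<exists>r. \<forall>V a b. 0 < a \<and> (\<forall>x. a * (x \<bullet> x) \<le> V x \<bullet> x \<and> V x \<bullet> x \<le> b * (x \<bullet> x))
      \<longrightarrow> (\<lambda>n. root n (\<Prod>k<n. rate V (g y x0) k)) \<longlonglongrightarrow> r"
    by (intro allI gradient_step.common_root_rate_limit)
  then obtain r where r: "\<And>y x0 V a b. \<lbrakk>0 < a; \<And>x. a * (x \<bullet> x) \<le> V x \<bullet> x; \<And>x. V x \<bullet> x \<le> b * (x \<bullet> x)\<rbrakk>
      \<Longrightarrow> (\<lambda>n. root n (\<Prod>k<n. rate V (g y x0) k)) \<longlonglongrightarrow> r y x0"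
    unfolding choice_iff by blast
  show ?thesis
  \<comment> \<open>The chosen limits \<open>r\<close> are indexed by \<open>y\<close> and
    \<open>x0\<close>, whereas \<open>R\<close> takes \<open>xstar\<close>; since
    \<open>xstar = inv A y\<close>, the vector \<open>y\<close> is recovered as
    \<open>A xstar\<close>.\<close>
  proof (intro exI[of _ "\<lambda>x0 xstar. r (A xstar) x0"] allI impI conjI)
    fix x0 xstar y assume "xstar = inv A y"
    then have y: "A xstar = y" by simp
    show "is_arg_min (quadratic_objective A y) (\<lambda>_. True) xstar"
      using quadratic_objective_arg_min[OF linear selfadjoint assms(3), of xstar] unfolding y .
    show "(\<lambda>n. root n (\<Prod>k<n. rate ?Q (g y x0) k)) \<longlonglongrightarrow> r (A xstar) x0"
      unfolding y by (rule r[OF e(1) Q_ge Q_le])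
    fix W :: "'a \<Rightarrow> 'a"
    assume W: "bounded_linear W \<and> selfadjoint_op W \<and> positive_op W \<and>
      0 < lower_bound_op W \<and> lower_bound_op W < upper_bound_op W \<and> W \<circ> A = A \<circ> W"
    show "(\<lambda>n. root n (\<Prod>k<n. rate W (g y x0) k)) \<longlonglongrightarrow> r (A xstar) x0"
      unfolding y
      by (rule r[of "lower_bound_op W" W "upper_bound_op W"])
        (use W in \<open>simp_all add: bounded_op_form_bounds\<close>)
  qed
qed

end
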